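(* Let $k\ge4$ be an integer, $a>0$, $\beta>0$, and $$c_k=\frac{2\left(1-(\frac13)^{k-1}\right)}{\frac{k-1}{k-2}\left(1-(\frac13)^{k-2}\right)-2\left(1-(\frac13)^{k-1}\right)}.$$ The model with Hamiltonian $$H(\sigma)=-\frac1\beta\sum_{\langle x,y\rangle}\ln\left(\frac{1+c_k(\sigma(x)-\frac12)(\sigma(y)-\frac12)}{a^k(\sigma(x)+\frac12)^k}\right)$$ on the Cayley tree $\Gamma^k$ of order $k$, where each edge $\langle x,y\rangle$ is written so that $x$ is a direct successor of $y$, has at least two periodic Gibbs measures (of period two).
   Context: The Cayley tree $\Gamma^k=(V,L)$ of order $k$ is the infinite tree in which every vertex has exactly $k+1$ incident edges. Fix a root $x^0$; $d$ is graph distance, $W_n=\{x: d(x,x^0)=n\}$, $V_n=\{x:d(x,x^0)\le n\}$. A neighbour $y$ of $x$ is a direct successor of $x$ if $d(y,x^0)=d(x,x^0)+1$; $S(x)$ is the set of direct successors of $x$. A vertex $x$ is even (odd) if $d(x,x^0)$ is even (odd). Configurations are functions $\sigma:V\to[0,1]$; $\lambda$ is Lebesgue measure on $[0,1]$, and $\lambda_A$ is the product measure on $\Omega_A=[0,1]^A$ for finite $A\subset V$. $H(\sigma_n)$, for $\sigma_n\in\Omega_{V_n}$, is the sum defining $H$ restricted to edges with both endpoints in $V_n$. Given functions $h_x=(h_{t,x})_{t\in[0,1]}$ for $x\in V\setminus\{x^0\}$, define for $n\ge1$ the probability densities with respect to $\lambda_{V_n}$ $$\mu^{(n)}(\sigma_n)=Z_n^{-1}\exp\Big(-\beta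 H(\sigma_n)+\sum_{x\in W_n}h_{\sigma_n(x),x}\Big),$$ with $Z_n$ the normalizing constant. They are compatible if $\int_{\Omega_{W_n}}\mu^{(n)}(\sigma_{n-1}\vee\omega_n)\,\lambda_{W_n}(d\omega_n)=\mu^{(n-1)}(\sigma_{n-1})$ for all $n\ge 2$ and $\sigma_{n-1}\in\Omega_{V_{n-1}}$, where $\vee$ denotes concatenation. In that case the unique probability measure $\mu$ on $[0,1]^V$ whose restriction to each $V_n$ has density $\mu^{(n)}$ is called the splitting Gibbs measure corresponding to $H$ and $h$. A periodic Gibbs measure (of period two) is a splitting Gibbs measure corresponding to some $h$ for which there are positive continuous functions $f\ne g$ on $[0,1]$ with $\exp(h_{t,x}-h_{0,x})=f(t)$ for all even $x\neq x^0$ and $=g(t)$ for all odd $x$, $t\in[0,1]$. *)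

theory Defs
  imports "HOL-Probability.Probability"
begin

section \<open>Cayley trees\<close>

text \<open>
  A simple graph is given by its vertex set \<open>V\<close> and its set \<open>L\<close> of edges, which are
  two-element subsets of \<open>V\<close>.
\<close>

definition simple_graph :: "'v set \<Rightarrow> 'v set set \<Rightarrow> bool" where
  "simple_graph V L \<longleftrightarrow> (\<forall>e\<in>L. e \<subseteq> V \<and> card e = 2)"

definition walk_between :: "'v set set \<Rightarrow> 'v \<Rightarrow> 'v list \<Rightarrow> 'v \<Rightarrow> bool" where
  "walk_between L x p y \<longleftrightarrow>
     p \<noteq> [] \<and> hd p = x \<and> last p = y \<and> successively (\<lambda>u v. {u, v} \<in> L) p"

definition graph_cycle :: "'v set set \<Rightarrow> 'v list \<Rightarrow> bool" where
  "graph_cycle L p \<longleftrightarrow>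
     length p \<ge> 3 \<and> distinct p \<and> successively (\<lambda>u v. {u, v} \<in> L) p \<and> {last p, hd p} \<in> L"

definition cayley_tree :: "nat \<Rightarrow> 'v set \<Rightarrow> 'v set set \<Rightarrow> bool" where
  "cayley_tree k V L \<longleftrightarrow>
     simple_graph V L \<and> infinite V \<and>
     (\<forall>x\<in>V. \<forall>y\<in>V. \<exists>p. walk_between L x p y) \<and>
     \<not> (\<exists>p. graph_cycle L p) \<and>
     (\<forall>x\<in>V. card {e \<in> L. x \<in> e} = k + 1)"

text \<open>A walk listing \<open>n + 1\<close> vertices has length \<open>n\<close>.\<close>

definition graph_dist :: "'v set set \<Rightarrow> 'v \<Rightarrow> 'v \<Rightarrow> nat" where
  "graph_dist L x y = (LEAST n. \<exists>p. walk_between L x p y \<and> length p = Suc n)"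

definition sphere_at :: "'v set \<Rightarrow> 'v set set \<Rightarrow> 'v \<Rightarrow> nat \<Rightarrow> 'v set" where
  "sphere_at V L x0 n = {x \<in> V. graph_dist L x x0 = n}"

definition ball_at :: "'v set \<Rightarrow> 'v set set \<Rightarrow> 'v \<Rightarrow> nat \<Rightarrow> 'v set" where
  "ball_at V L x0 n = {x \<in> V. graph_dist L x x0 \<le> n}"

definition direct_successors :: "'v set set \<Rightarrow> 'v \<Rightarrow> 'v \<Rightarrow> 'v set" where
  "direct_successors L x0 x = {y. {x, y} \<in> L \<and> graph_dist L y x0 = graph_dist L x x0 + 1}"


section \<open>Splitting Gibbs measures\<close>

definition unit_measure :: "real measure" where
  "unit_measure = restrict_space lborel {0..1}"

text \<open>
  The configuration space \<open>[0,1]\<^sup>A\<close> with its product sigma-algebra and product measure.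
  Configurations on \<open>A\<close> are extensional functions, i.e. elements of \<open>A \<rightarrow>\<^sub>E {0..1}\<close>.
\<close>

definition config_measure :: "'v set \<Rightarrow> ('v \<Rightarrow> real) measure" where
  "config_measure A = PiM A (\<lambda>_. unit_measure)"

text \<open>
  The sum defining a nearest-neighbour Hamiltonian, restricted to the edges inside \<open>A\<close>.
  The pair interaction \<open>\<phi>\<close> need not be symmetric: its first argument is the spin at the
  endpoint farther from the root. In a tree each edge is counted exactly once, as the pair
  \<open>(x, y)\<close> with \<open>x\<close> a direct successor of \<open>y\<close>.
\<close>

definition hamiltonian ::
  "'v set set \<Rightarrow> 'v \<Rightarrow> (real \<Rightarrow> real \<Rightarrow> real) \<Rightarrow> 'v set \<Rightarrow> ('v \<Rightarrow> real) \<Rightarrow> real" where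
  "hamiltonian L x0 \<phi> A \<sigma> =
     (\<Sum>(x, y) \<in> {(x, y). x \<in> A \<and> y \<in> A \<and> x \<in> direct_successors L x0 y}. \<phi> (\<sigma> x) (\<sigma> y))"

text \<open>
  In what follows \<open>h t x\<close> stands for $h_{t,x}$; its values at \<open>x = x0\<close> and for \<open>t\<close> outside
  \<open>[0,1]\<close> are irrelevant.
\<close>

definition gibbs_weight ::
  "'v set \<Rightarrow> 'v set set \<Rightarrow> 'v \<Rightarrow> real \<Rightarrow> (real \<Rightarrow> real \<Rightarrow> real) \<Rightarrow> (real \<Rightarrow> 'v \<Rightarrow> real)
    \<Rightarrow> nat \<Rightarrow> ('v \<Rightarrow> real) \<Rightarrow> real" where
  "gibbs_weight V L x0 \<beta> \<phi> h n \<sigma> =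
     exp (- \<beta> * hamiltonian L x0 \<phi> (ball_at V L x0 n) \<sigma> + (\<Sum>x\<in>sphere_at V L x0 n. h (\<sigma> x) x))"

definition partition_fn ::
  "'v set \<Rightarrow> 'v set set \<Rightarrow> 'v \<Rightarrow> real \<Rightarrow> (real \<Rightarrow> real \<Rightarrow> real) \<Rightarrow> (real \<Rightarrow> 'v \<Rightarrow> real)
    \<Rightarrow> nat \<Rightarrow> real" where
  "partition_fn V L x0 \<beta> \<phi> h n =
     (\<integral>\<sigma>. gibbs_weight V L x0 \<beta> \<phi> h n \<sigma> \<partial>config_measure (ball_at V L x0 n))"

definition gibbs_density ::
  "'v set \<Rightarrow> 'v set set \<Rightarrow> 'v \<Rightarrow> real \<Rightarrow> (real \<Rightarrow> real \<Rightarrow> real) \<Rightarrow> (real \<Rightarrow> 'v \<Rightarrow> real)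
    \<Rightarrow> nat \<Rightarrow> ('v \<Rightarrow> real) \<Rightarrow> real" where
  "gibbs_density V L x0 \<beta> \<phi> h n \<sigma> =
     gibbs_weight V L x0 \<beta> \<phi> h n \<sigma> / partition_fn V L x0 \<beta> \<phi> h n"

text \<open>
  Integrability expresses that \<^const>\<open>partition_fn\<close> is a genuine finite normalizing constant
  (it is then automatically positive), so that \<^const>\<open>gibbs_density\<close> is a probability density.
\<close>

definition gibbs_normalizable ::
  "'v set \<Rightarrow> 'v set set \<Rightarrow> 'v \<Rightarrow> real \<Rightarrow> (real \<Rightarrow> real \<Rightarrow> real) \<Rightarrow> (real \<Rightarrow> 'v \<Rightarrow> real)
    \<Rightarrow> bool" where
  "gibbs_normalizable V L x0 \<beta> \<phi> h \<longleftrightarrow>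
     (\<forall>n\<ge>1. integrable (config_measure (ball_at V L x0 n)) (gibbs_weight V L x0 \<beta> \<phi> h n))"

definition gibbs_compatible ::
  "'v set \<Rightarrow> 'v set set \<Rightarrow> 'v \<Rightarrow> real \<Rightarrow> (real \<Rightarrow> real \<Rightarrow> real) \<Rightarrow> (real \<Rightarrow> 'v \<Rightarrow> real)
    \<Rightarrow> bool" where
  "gibbs_compatible V L x0 \<beta> \<phi> h \<longleftrightarrow>
     (\<forall>n\<ge>2. \<forall>\<sigma> \<in> ball_at V L x0 (n - 1) \<rightarrow>\<^sub>E {0..1}.
        (\<integral>\<omega>. gibbs_density V L x0 \<beta> \<phi> h n
               (merge (ball_at V L x0 (n - 1)) (sphere_at V L x0 n) (\<sigma>, \<omega>))
           \<partial>config_measure (sphere_at V L x0 n))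
        = gibbs_density V L x0 \<beta> \<phi> h (n - 1) \<sigma>)"

definition splitting_gibbs_measure ::
  "'v set \<Rightarrow> 'v set set \<Rightarrow> 'v \<Rightarrow> real \<Rightarrow> (real \<Rightarrow> real \<Rightarrow> real) \<Rightarrow> (real \<Rightarrow> 'v \<Rightarrow> real)
    \<Rightarrow> ('v \<Rightarrow> real) measure \<Rightarrow> bool" where
  "splitting_gibbs_measure V L x0 \<beta> \<phi> h \<mu> \<longleftrightarrow>
     gibbs_normalizable V L x0 \<beta> \<phi> h \<and> gibbs_compatible V L x0 \<beta> \<phi> h \<and>
     prob_space \<mu> \<and> sets \<mu> = sets (config_measure V) \<and>
     (\<forall>n\<ge>1. distr \<mu> (config_measure (ball_at V L x0 n)) (\<lambda>\<sigma>. restrict \<sigma> (ball_at V L x0 n))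
        = density (config_measure (ball_at V L x0 n))
            (\<lambda>\<sigma>. ennreal (gibbs_density V L x0 \<beta> \<phi> h n \<sigma>)))"

text \<open>Period two: the boundary function depends on the parity of the vertex only.\<close>

definition periodic_gibbs_measure ::
  "'v set \<Rightarrow> 'v set set \<Rightarrow> 'v \<Rightarrow> real \<Rightarrow> (real \<Rightarrow> real \<Rightarrow> real) \<Rightarrow> ('v \<Rightarrow> real) measure
    \<Rightarrow> bool" where
  "periodic_gibbs_measure V L x0 \<beta> \<phi> \<mu> \<longleftrightarrow>
     (\<exists>h f g.
        splitting_gibbs_measure V L x0 \<beta> \<phi> h \<mu> \<and>
        continuous_on {0..1} f \<and> continuous_on {0..1} g \<and>
        (\<forall>t\<in>{0..1}. f t > 0 \<and> g t > 0) \<and>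
        (\<exists>t\<in>{0..1}. f t \<noteq> g t) \<and>
        (\<forall>x\<in>V - {x0}. \<forall>t\<in>{0..1}.
           exp (h t x - h 0 x) = (if even (graph_dist L x x0) then f t else g t)))"


section \<open>The model\<close>

definition coupling_const :: "nat \<Rightarrow> real" where
  "coupling_const k =
     2 * (1 - (1/3) ^ (k - 1)) /
     ((real k - 1) / (real k - 2) * (1 - (1/3) ^ (k - 2)) - 2 * (1 - (1/3) ^ (k - 1)))"

definition model_interaction :: "nat \<Rightarrow> real \<Rightarrow> real \<Rightarrow> real \<Rightarrow> real \<Rightarrow> real" where
  "model_interaction k a \<beta> s t =
     - (1 / \<beta>) * ln ((1 + coupling_const k * (s - 1/2) * (t - 1/2)) / (a ^ k * (s + 1/2) ^ k))"

end

(*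
  A boundary law gives a splitting Gibbs measure as soon as exp (h t y) is proportional to the
  product, over the direct successors x of y, of the integrals of exp (- beta phi s t + h s x) over
  s.  Here the kernel is (1 + c (s - 1/2) (t - 1/2)) / (a^k (s + 1/2)^k), and c = c_k is exactly the
  value for which the constant 1 is sent to a multiple of t + 1/2; since the integral of s - 1/2
  vanishes, (t + 1/2)^k is in turn sent to a constant.  Hence (2 t + 1)^k on one parity class and 1
  on the other is a boundary law, and so is the law with the two classes exchanged.  The two measures
  differ because the quotient of their densities on the ball of radius one is a constant times the
  product of (2 s_x + 1)^k over the sphere, which is not almost everywhere constant.
*)

theory Submission
  imports Defs
begin

section \<open>Distances in a rooted Cayley tree\<close>

text \<open>With u = s + 1/2 and I_j the integral of u^(-j) over [1/2, 3/2], the kernel sends the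
  constant 1, up to the factor a^(-k), to I_k + c (I_(k-1) - I_k) (t - 1/2). This is proportional to
  t + 1/2 = 1 + (t - 1/2) exactly when c (I_(k-1) - I_k) = I_k, and solving for c gives the formula
  for c_k. The value is negative. For k \<ge> 4 it satisfies |c_k| < 4, which keeps 1 + c_k (s -
  1/2) (t - 1/2) positive on the whole unit square; k = 3 would give c_k = -4 and a zero at two
  corners. A vertex other than the root has k successors, each contributing a factor t + 1/2, and
  this produces the very power that cancels the denominator of the kernel one level further up. The
  root has k + 1 successors, but compatibility is demanded from n = 2 on, so the boundary law is an
  equation at the other vertices only. Different boundary functions may define the same measure (add
  constants to h), so that the two measures differ has to be read off their densities.\<close>

lemma successively_append_Cons:
  "successively P (xs @ y # ys) \<longleftrightarrow> successively P (xs @ [y]) \<and> successively P (y # ys)"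
  by (auto simp: successively_append_iff successively_Cons)

lemma walk_between_Cons:
  assumes "{x, y} \<in> L" "walk_between L y p z"
  shows "walk_between L x (x # p) z"
  using assms by (auto simp: walk_between_def successively_Cons)

lemma walk_between_append:
  assumes "walk_between L x p y" "walk_between L y (y # q) z"
  shows "walk_between L x (p @ q) z"
proof -
  obtain p' where p: "p = p' @ [y]"
    using assms(1) by (metis append_butlast_last_id walk_between_def)
  show ?thesis
    using assms unfolding p walk_between_def
    by (auto simp: successively_append_Cons[of _ p' y q] hd_append)
qed

lemma walk_between_rev:
  assumes "walk_between L x p y"
  shows "walk_between L y (rev p) x"
  using assms by (simp add: walk_between_def hd_rev last_rev insert_commute)

text \<open>Cutting out the closed stretch between two occurrences of a vertex shortens the walk.
  Staying inside \<open>set p\<close> preserves the avoidance of a given vertex, which is needed to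
  close a cycle through that vertex.\<close>

lemma walk_between_imp_distinct:
  assumes "walk_between L x p y"
  obtains q where "walk_between L x q y" "distinct q" "set q \<subseteq> set p"
proof -
  have "\<exists>q. walk_between L x q y \<and> distinct q \<and> set q \<subseteq> set p"
    using assms
  proof (induction "length p" arbitrary: p rule: less_induct)
    case less
    show ?case
    proof (cases "distinct p")
      case True
      with less.prems show ?thesis by blast
    next
      case False
      then obtain xs ys zs v where p: "p = xs @ [v] @ ys @ [v] @ zs"
        using not_distinct_decomp by blast
      have "walk_between L x (xs @ v # zs) y"
        using less.prems unfolding p walk_between_def
        using successively_append_Cons[of _ xs v "ys @ v # zs"]
          successively_append_Cons[of _ "v # ys" v zs] successively_append_Cons[of _ xs v zs]
        by (auto simp: hd_append)
      from less.hyps[OF _ this] show ?thesis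
        unfolding p by fastforce
    qed
  qed
  with that show thesis by blast
qed

text \<open>Made simple, the walk still avoids \<open>x\<close>, so prefixing \<open>x\<close>
  closes it up; \<open>y \<noteq> z\<close> gives the walk at least two vertices and hence the cycle
  at least three.\<close>

lemma graph_cycle_at_vertex:
  assumes "walk_between L y p z" "x \<notin> set p" "y \<noteq> z" "{x, y} \<in> L" "{x, z} \<in> L"
  shows "\<exists>c. graph_cycle L c"
proof -
  obtain q where q: "walk_between L y q z" "distinct q" "set q \<subseteq> set p"
    using walk_between_imp_distinct[OF assms(1)] .
  obtain u v r where uvr: "q = u # v # r"
    using q(1) assms(3) by (cases q rule: remdups_adj.cases) (auto simp: walk_between_def)
  have "graph_cycle L (x # q)"
    using q assms uvr by (auto simp: graph_cycle_def walk_between_def insert_commute)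
  then show ?thesis ..
qed

lemma graph_dist_le:
  assumes "walk_between L x p y"
  shows "graph_dist L x y \<le> length p - 1"
  unfolding graph_dist_def
  using assms by (intro Least_le exI[of _ p]) (auto simp: walk_between_def)

text \<open>A walk of any length makes the set under \<open>LEAST\<close> nonempty, so the minimum
  is attained.\<close>

lemma graph_dist_walk:
  assumes "walk_between L x p y"
  obtains q where "walk_between L x q y" "length q = Suc (graph_dist L x y)"
proof -
  have "\<exists>n q. walk_between L x q y \<and> length q = Suc n"
    using assms by (intro exI[of _ "length p - 1"] exI[of _ p]) (auto simp: walk_between_def)
  then have "\<exists>q. walk_between L x q y \<and> length q = Suc (graph_dist L x y)"
    unfolding graph_dist_def by (rule LeastI_ex)
  with that show thesis by blast
qed

section \<open>Parents, successors and degrees in the rooted tree\<close>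

locale rooted_cayley_tree =
  fixes V :: "'v set" and L :: "'v set set" and x0 :: 'v and k :: nat
  assumes tree: "cayley_tree k V L" and root: "x0 \<in> V"
begin

abbreviation "depth x \<equiv> graph_dist L x x0"
abbreviation "tree_ball \<equiv> ball_at V L x0"
abbreviation "tree_sphere \<equiv> sphere_at V L x0"
abbreviation "children \<equiv> direct_successors L x0"

lemma edge_in_V: "{x, y} \<in> L \<Longrightarrow> x \<in> V \<and> y \<in> V \<and> x \<noteq> y"
  using tree unfolding cayley_tree_def simple_graph_def by fastforce

lemma walk_exists: "x \<in> V \<Longrightarrow> y \<in> V \<Longrightarrow> \<exists>p. walk_between L x p y"
  using tree unfolding cayley_tree_def by blast

lemma no_cycle: "\<not> graph_cycle L p"
  using tree unfolding cayley_tree_def by blast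

lemma degree: "x \<in> V \<Longrightarrow> card {e \<in> L. x \<in> e} = k + 1"
  using tree unfolding cayley_tree_def by blast

lemma depth_root [simp]: "depth x0 = 0"
  using graph_dist_le[of L x0 "[x0]" x0] by (simp add: walk_between_def)

lemma depth_eq_0: "x \<in> V \<Longrightarrow> depth x = 0 \<longleftrightarrow> x = x0"
proof
  assume x: "x \<in> V" and 0: "depth x = 0"
  obtain p where "walk_between L x p x0" "length p = Suc 0"
    using graph_dist_walk walk_exists[OF x root] 0 by metis
  then show "x = x0" by (auto simp: walk_between_def length_Suc_conv)
qed simp

lemma depth_le_Suc:
  assumes "{x, y} \<in> L"
  shows "depth x \<le> Suc (depth y)"
proof -
  obtain p where p: "walk_between L y p x0" "length p = Suc (depth y)"
    using graph_dist_walk walk_exists root edge_in_V[OF assms] by metis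
  from graph_dist_le[OF walk_between_Cons[OF assms p(1)]] p(2) show ?thesis by simp
qed

text \<open>The second vertex of a shortest walk to the root is one step closer to it.\<close>

lemma parent_exists:
  assumes "x \<in> V" "x \<noteq> x0"
  shows "\<exists>y. x \<in> children y"
proof -
  obtain p where p: "walk_between L x p x0" "length p = Suc (depth x)"
    using graph_dist_walk walk_exists root assms by metis
  obtain y q where q: "p = x # y # q"
    using p(1) assms(2) by (cases p rule: remdups_adj.cases) (auto simp: walk_between_def)
  have e: "{x, y} \<in> L" and "walk_between L y (y # q) x0"
    using p(1) q by (auto simp: walk_between_def)
  then have "depth y \<le> length q" using graph_dist_le[of L y "y # q"] by simp
  then have "depth x = depth y + 1" using p(2) q depth_le_Suc[OF e] by simp
  with e show ?thesis by (auto simp: direct_successors_def insert_commute)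
qed

text \<open>Obtained by iterating the parent step. Its use lies in the strict inequality: started at
  a neighbour of a vertex \<open>w\<close> that is no deeper than \<open>w\<close>, such a walk
  reaches the root without meeting \<open>w\<close>.\<close>

lemma descending_walk:
  assumes "x \<in> V"
  shows "\<exists>p. walk_between L x p x0 \<and> (\<forall>y\<in>set p. y = x \<or> depth y < depth x)"
  using assms
proof (induction "depth x" arbitrary: x)
  case 0
  then have "x = x0" by (metis depth_eq_0)
  then show ?case by (intro exI[of _ "[x0]"]) (simp add: walk_between_def)
next
  case (Suc n)
  then have "x \<noteq> x0" by auto
  then obtain y where y: "{y, x} \<in> L" "depth x = depth y + 1"
    using parent_exists Suc.prems by (auto simp: direct_successors_def)
  then obtain p where p: "walk_between L y p x0" "\<forall>z\<in>set p. z = y \<or> depth z < depth y"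
    using Suc edge_in_V[OF y(1)] by force
  have "walk_between L x (x # p) x0"
    using walk_between_Cons[OF _ p(1)] y(1) by (simp add: insert_commute)
  moreover have "\<forall>z\<in>set (x # p). z = x \<or> depth z < depth x"
    using p(2) y(2) by auto
  ultimately show ?case by blast
qed

text \<open>Distinct such neighbours would be joined through the root by a walk avoiding \<open>x\<close>,
  which closes up to a cycle.\<close>

lemma neighbour_le_depth_unique:
  assumes "{x, y} \<in> L" "{x, z} \<in> L" "depth y \<le> depth x" "depth z \<le> depth x"
  shows "y = z"
proof (rule ccontr)
  assume "y \<noteq> z"
  obtain p where p: "walk_between L y p x0" "\<forall>u\<in>set p. u = y \<or> depth u < depth y"
    using descending_walk edge_in_V assms(1) by blast
  obtain q where q: "walk_between L z q x0" "\<forall>u\<in>set q. u = z \<or> depth u < depth z"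
    using descending_walk edge_in_V assms(2) by blast
  have r: "walk_between L x0 (rev q) z" using q(1) by (rule walk_between_rev)
  then obtain r where r': "rev q = x0 # r"
    by (cases "rev q") (auto simp: walk_between_def)
  have w: "walk_between L y (p @ r) z"
    using walk_between_append[OF p(1)] r r' by simp
  have "set r \<subseteq> set q" using r' by (metis set_rev set_subset_Cons)
  then have "x \<notin> set (p @ r)"
    using p(2) q(2) assms edge_in_V[OF assms(1)] edge_in_V[OF assms(2)] by fastforce
  from graph_cycle_at_vertex[OF w this \<open>y \<noteq> z\<close> assms(1,2)] show False
    using no_cycle by blast
qed

text \<open>At the root no vertex qualifies and the value is unspecified, so the function is applied
  to other vertices only.\<close>

definition parent :: "'v \<Rightarrow> 'v" where
  "parent x = (THE y. x \<in> children y)"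

lemma children_iff_parent:
  assumes "x \<in> V" "x \<noteq> x0"
  shows "x \<in> children y \<longleftrightarrow> y = parent x"
proof -
  obtain p where p: "x \<in> children p" using parent_exists[OF assms] ..
  have "q = p" if "x \<in> children q" for q
    using that p
    by (intro neighbour_le_depth_unique[of x]) (simp_all add: direct_successors_def insert_commute)
  with p have "\<exists>!y. x \<in> children y" by blast
  from theI'[OF this] this show ?thesis unfolding parent_def by blast
qed

lemma children_subset: "children y \<subseteq> V - {x0}"
  using edge_in_V by (fastforce simp: direct_successors_def)

lemma parent_edge:
  assumes "x \<in> V" "x \<noteq> x0"
  shows "{x, parent x} \<in> L" "parent x \<in> V" "depth x = Suc (depth (parent x))"
  using children_iff_parent[OF assms, of "parent x"] edge_in_V
  by (auto simp: direct_successors_def insert_commute)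

text \<open>The degree condition counts edges; the bijection sending \<open>y\<close> to
  \<open>{x, y}\<close> transfers it to vertices.\<close>

lemma card_neighbours:
  assumes "x \<in> V"
  shows "card {y. {x, y} \<in> L} = k + 1"
proof -
  have "bij_betw (\<lambda>y. {x, y}) {y. {x, y} \<in> L} {e \<in> L. x \<in> e}"
    unfolding bij_betw_def
  proof
    show "inj_on (\<lambda>y. {x, y}) {y. {x, y} \<in> L}"
      by (auto simp: inj_on_def doubleton_eq_iff)
    show "(\<lambda>y. {x, y}) ` {y. {x, y} \<in> L} = {e \<in> L. x \<in> e}"
    proof (intro equalityI subsetI)
      fix e assume e: "e \<in> {e \<in> L. x \<in> e}"
      then have "card e = 2" using tree unfolding cayley_tree_def simple_graph_def by blast
      then obtain u v where "e = {u, v}" by (auto simp: card_2_iff)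
      with e show "e \<in> (\<lambda>y. {x, y}) ` {y. {x, y} \<in> L}"
        by (auto simp: insert_commute image_iff)
    qed auto
  qed
  from bij_betw_same_card[OF this] degree[OF assms] show ?thesis by simp
qed

text \<open>\<open>card\<close> is 0 on infinite sets, so a positive cardinality forces
  finiteness.\<close>

lemma finite_neighbours: "x \<in> V \<Longrightarrow> finite {y. {x, y} \<in> L}"
  using card_neighbours[of x] by (metis Suc_eq_plus1 card.infinite nat.distinct(1))

lemma finite_children: "x \<in> V \<Longrightarrow> finite (children x)"
  using finite_neighbours[of x] by (rule finite_subset[rotated]) (auto simp: direct_successors_def)

lemma children_root: "children x0 = {y. {x0, y} \<in> L}"
proof -
  have "depth y = 1" if "{x0, y} \<in> L" for y
    using depth_le_Suc[of y x0] depth_eq_0[of y] edge_in_V[OF that] that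
    by (auto simp: insert_commute le_Suc_eq)
  then show ?thesis by (auto simp: direct_successors_def)
qed

text \<open>With the parent as one of the two neighbours, \<open>neighbour_le_depth_unique\<close>
  excludes edges inside a sphere as well as second parents. So all of the k + 1 neighbours except
  the parent are successors.\<close>

lemma card_children:
  assumes "x \<in> V" "x \<noteq> x0"
  shows "card (children x) = k"
proof -
  have "depth y = depth x + 1" if e: "{x, y} \<in> L" and ne: "y \<noteq> parent x" for y
  proof -
    have "\<not> depth y \<le> depth x"
      using neighbour_le_depth_unique[OF e parent_edge(1)[OF assms]] ne parent_edge(3)[OF assms]
      by auto
    then show ?thesis using depth_le_Suc[of y x] e by (simp add: insert_commute)
  qed
  then have "children x = {y. {x, y} \<in> L} - {parent x}"
    using parent_edge(3)[OF assms] by (auto simp: direct_successors_def)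
  then show ?thesis
    using card_neighbours[OF assms(1)] parent_edge(1)[OF assms] finite_neighbours[OF assms(1)]
    by simp
qed

section \<open>Balls and spheres around the root\<close>

lemma ball_0: "tree_ball 0 = {x0}"
  using root by (auto simp: ball_at_def depth_eq_0)

lemma ball_Suc: "tree_ball (Suc n) = tree_ball n \<union> tree_sphere (Suc n)"
  by (auto simp: ball_at_def sphere_at_def)

lemma ball_sphere_disjoint: "tree_ball n \<inter> tree_sphere (Suc n) = {}"
  by (auto simp: ball_at_def sphere_at_def)

lemma sphere_subset_ball: "tree_sphere n \<subseteq> tree_ball n"
  by (auto simp: ball_at_def sphere_at_def)

lemma ball_subset_V: "tree_ball n \<subseteq> V"
  by (auto simp: ball_at_def)

text \<open>The shift by one matches the finite-volume densities, which start at radius 1.\<close>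

lemma Union_ball: "(\<Union>n. tree_ball (Suc n)) = V"
proof (intro equalityI subsetI)
  fix x assume "x \<in> V"
  then have "x \<in> tree_ball (Suc (depth x))" by (simp add: ball_at_def)
  then show "x \<in> (\<Union>n. tree_ball (Suc n))" by blast
qed (simp add: ball_at_def)

lemma sphere_Suc: "tree_sphere (Suc n) = (\<Union>y\<in>tree_sphere n. children y)"
proof (intro equalityI subsetI)
  fix x assume "x \<in> tree_sphere (Suc n)"
  then have x: "x \<in> V" "x \<noteq> x0" "depth x = Suc n" by (auto simp: sphere_at_def)
  then have "x \<in> children (parent x)" "parent x \<in> tree_sphere n"
    using parent_edge[OF x(1,2)] children_iff_parent by (auto simp: sphere_at_def)
  then show "x \<in> (\<Union>y\<in>tree_sphere n. children y)" by blast
next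
  fix x assume "x \<in> (\<Union>y\<in>tree_sphere n. children y)"
  then show "x \<in> tree_sphere (Suc n)"
    using children_subset by (auto simp: sphere_at_def direct_successors_def)
qed

lemma finite_ball: "finite (tree_ball n)"
proof -
  have "finite (tree_sphere n)" for n
  proof (induction n)
    case 0
    have "tree_sphere 0 \<subseteq> tree_ball 0" by (rule sphere_subset_ball)
    then show ?case by (simp add: ball_0 finite_subset)
  next
    case (Suc n)
    then show ?case
      unfolding sphere_Suc by (auto simp: sphere_at_def finite_children)
  qed
  then show ?thesis by (induction n) (simp_all add: ball_0 ball_Suc)
qed

lemma finite_sphere: "finite (tree_sphere n)"
  using finite_ball sphere_subset_ball by (rule finite_subset[rotated])

text \<open>Parents are unique, so the sets of children of the vertices of a sphere are disjoint.
  Regrouping by parent is what lets the boundary equation at a single vertex act on an integral over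
  a whole sphere.\<close>

lemma prod_sphere_Suc:
  fixes f :: "'v \<Rightarrow> 'v \<Rightarrow> 'a::comm_monoid_mult"
  shows "(\<Prod>x\<in>tree_sphere (Suc n). f x (parent x)) = (\<Prod>y\<in>tree_sphere n. \<Prod>x\<in>children y. f x y)"
proof -
  have V: "y \<in> V" if "y \<in> tree_sphere n" for y using that by (auto simp: sphere_at_def)
  have par: "parent x = y" if "x \<in> children y" for x y
    using that children_iff_parent[of x y] children_subset[of y] by auto
  have "(\<Prod>x\<in>tree_sphere (Suc n). f x (parent x)) = (\<Prod>y\<in>tree_sphere n. \<Prod>x\<in>children y. f x (parent x))"
    unfolding sphere_Suc
  proof (rule prod.UNION_disjoint)
    show "\<forall>y\<in>tree_sphere n. \<forall>z\<in>tree_sphere n. y \<noteq> z \<longrightarrow> children y \<inter> children z = {}"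
      using par by (metis disjoint_iff)
  qed (simp_all add: finite_sphere finite_children V)
  also have "\<dots> = (\<Prod>y\<in>tree_sphere n. \<Prod>x\<in>children y. f x y)"
    by (intro prod.cong refl) (simp add: par)
  finally show ?thesis .
qed

lemma parent_in_ball:
  assumes "x \<in> tree_ball n - {x0}"
  shows "parent x \<in> tree_ball n"
  using assms parent_edge[of x] by (auto simp: ball_at_def)

lemma parent_in_sphere:
  assumes "x \<in> tree_sphere (Suc n)"
  shows "parent x \<in> tree_sphere n"
  using assms parent_edge[of x] by (cases "x = x0") (auto simp: sphere_at_def)

text \<open>An edge is determined by its farther endpoint, and every vertex of the ball except the
  root is the farther endpoint of an edge inside the ball.\<close>

lemma hamiltonian_eq_sum_parent:
  "hamiltonian L x0 \<phi> (tree_ball n) \<sigma> = (\<Sum>x\<in>tree_ball n - {x0}. \<phi> (\<sigma> x) (\<sigma> (parent x)))"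
proof -
  have "{(x, y). x \<in> tree_ball n \<and> y \<in> tree_ball n \<and> x \<in> children y}
    = (\<lambda>x. (x, parent x)) ` (tree_ball n - {x0})"
  proof (intro equalityI subsetI)
    fix e assume "e \<in> {(x, y). x \<in> tree_ball n \<and> y \<in> tree_ball n \<and> x \<in> children y}"
    then obtain x y where e: "e = (x, y)" and x: "x \<in> tree_ball n" "x \<in> children y" by blast
    then have "x \<in> V" "x \<noteq> x0" using children_subset[of y] by blast+
    with x e show "e \<in> (\<lambda>x. (x, parent x)) ` (tree_ball n - {x0})"
      by (simp add: children_iff_parent)
  next
    fix e assume "e \<in> (\<lambda>x. (x, parent x)) ` (tree_ball n - {x0})"
    then obtain x where e: "e = (x, parent x)" and x: "x \<in> tree_ball n - {x0}" by blast
    then have "x \<in> V" "x \<noteq> x0" using ball_subset_V by blast+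
    with x e show "e \<in> {(x, y). x \<in> tree_ball n \<and> y \<in> tree_ball n \<and> x \<in> children y}"
      using parent_in_ball[OF x] by (simp add: children_iff_parent)
  qed
  then show ?thesis
    unfolding hamiltonian_def by (simp add: sum.reindex inj_on_def)
qed

end

section \<open>The configuration space\<close>

lemma space_unit_measure [simp]: "space unit_measure = {0..1}"
  by (simp add: unit_measure_def space_restrict_space)

lemma sets_unit_measure: "sets unit_measure = sets (restrict_space borel {0..1})"
  by (simp add: unit_measure_def sets_restrict_space)

lemma space_config_measure: "space (config_measure A) = A \<rightarrow>\<^sub>E {0..1}"
  by (simp add: config_measure_def space_PiM)

interpretation unit_measure: prob_space unit_measure
  by standard (simp add: unit_measure_def emeasure_restrict_space space_restrict_space)

interpretation unit_product: product_sigma_finite "\<lambda>_. unit_measure"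
  by standard

lemma prob_space_config_measure: "prob_space (config_measure A)"
  unfolding config_measure_def by (rule prob_space_PiM) (rule unit_measure.prob_space_axioms)

lemma measurable_unit_measure_ident: "(\<lambda>t. t) \<in> unit_measure \<rightarrow>\<^sub>M borel"
  by (simp add: unit_measure_def measurable_restrict_space1)

lemma measurable_clip: "(\<lambda>t::real. max 0 (min 1 t)) \<in> borel \<rightarrow>\<^sub>M unit_measure"
  by (subst measurable_cong_sets[OF refl sets_unit_measure])
    (auto intro!: measurable_restrict_space2)

lemma measurable_restrict_config:
  "A \<subseteq> B \<Longrightarrow> (\<lambda>\<sigma>. restrict \<sigma> A) \<in> config_measure B \<rightarrow>\<^sub>M config_measure A"
  unfolding config_measure_def by (rule measurable_restrict_subset)

lemma measurable_config_borel:
  "A \<subseteq> B \<Longrightarrow> (\<lambda>\<sigma>. restrict \<sigma> A) \<in> config_measure B \<rightarrow>\<^sub>M PiM A (\<lambda>_. borel)"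
  unfolding config_measure_def
  by (intro measurable_restrict measurable_compose[OF _ measurable_unit_measure_ident]
      measurable_component_singleton) auto

text \<open>
  Kolmogorov extension is available for the Borel space of a Polish type only, so the spins are
  embedded into \<open>\<real>\<close> and the limit measure is clipped back to \<open>[0,1]\<close>.
\<close>

lemma config_projective_limit:
  fixes B :: "nat \<Rightarrow> 'v set" and Q :: "nat \<Rightarrow> ('v \<Rightarrow> real) measure"
  assumes fin: "\<And>n. finite (B n)" and mono: "\<And>n. B n \<subseteq> B (Suc n)" and un: "(\<Union>n. B n) = V"
    and prob: "\<And>n. prob_space (Q n)" and sets: "\<And>n. sets (Q n) = sets (config_measure (B n))"
    and cons: "\<And>n. distr (Q (Suc n)) (config_measure (B n)) (\<lambda>\<sigma>. restrict \<sigma> (B n)) = Q n"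
  obtains \<mu> where "prob_space \<mu>" "sets \<mu> = sets (config_measure V)"
    "\<And>n. distr \<mu> (config_measure (B n)) (\<lambda>\<sigma>. restrict \<sigma> (B n)) = Q n"
proof -
  let ?clip = "\<lambda>t::real. max 0 (min 1 t)"
  have le: "B m \<subseteq> B n" if "m \<le> n" for m n
    using that by (rule lift_Suc_mono_le[of B, OF mono])
  have meas_Q: "f \<in> Q n \<rightarrow>\<^sub>M N \<longleftrightarrow> f \<in> config_measure (B n) \<rightarrow>\<^sub>M N" for f N n
    by (simp add: measurable_cong_sets[OF sets refl])
  have cons': "distr (Q n) (config_measure (B m)) (\<lambda>\<sigma>. restrict \<sigma> (B m)) = Q m" if "m \<le> n" for m n
    using that
  proof (induction n rule: dec_induct)
    case base
    have "distr (Q m) (config_measure (B m)) (\<lambda>\<sigma>. restrict \<sigma> (B m)) = distr (Q m) (Q m) (\<lambda>\<sigma>. \<sigma>)"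
    proof (rule distr_cong)
      fix \<sigma> assume "\<sigma> \<in> space (Q m)"
      then have "\<sigma> \<in> B m \<rightarrow>\<^sub>E {0..1}"
        using sets_eq_imp_space_eq[OF sets] by (simp add: space_config_measure)
      then show "restrict \<sigma> (B m) = \<sigma>" by (rule PiE_restrict)
    qed (simp_all add: sets)
    also have "\<dots> = Q m" by (rule distr_id2) simp
    finally show ?case .
  next
    case (step n)
    have "Q m = distr (distr (Q (Suc n)) (config_measure (B n)) (\<lambda>\<sigma>. restrict \<sigma> (B n)))
        (config_measure (B m)) (\<lambda>\<sigma>. restrict \<sigma> (B m))"
      by (simp add: cons step.IH)
    also have "\<dots> = distr (Q (Suc n)) (config_measure (B m)) (\<lambda>\<sigma>. restrict \<sigma> (B m))"
      using le[OF step.hyps(1)] mono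
      by (subst distr_distr)
        (auto simp: meas_Q comp_def Int_absorb1 intro!: measurable_restrict_config)
    finally show ?case ..
  qed
  \<comment> \<open>A finite set lies in one of the increasing sets \<open>B n\<close>. The first
    one is chosen for definiteness; by consistency every other one induces the same marginal on
    \<open>J\<close>.\<close>
  define N where "N J = (LEAST n. J \<subseteq> B n)" for J
  have N: "J \<subseteq> B (N J)" if "finite J" "J \<subseteq> V" for J
  proof -
    have "\<exists>n. J \<subseteq> B n"
      using that
    proof (induction J rule: finite_induct)
      case (insert x J)
      then obtain m n where "x \<in> B m" "J \<subseteq> B n" using un by auto
      then have "insert x J \<subseteq> B (max m n)"
        using le[of m "max m n"] le[of n "max m n"] by auto
      then show ?case ..
    qed simp
    then show ?thesis unfolding N_def by (rule LeastI_ex)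
  qed
  define P where "P J = distr (Q (N J)) (PiM J (\<lambda>_. borel)) (\<lambda>\<sigma>. restrict \<sigma> J)" for J
  have P: "P J = distr (Q n) (PiM J (\<lambda>_. borel)) (\<lambda>\<sigma>. restrict \<sigma> J)"
    if J: "finite J" "J \<subseteq> B n" for J n
  proof -
    have 1: "N J \<le> n" unfolding N_def by (rule Least_le) (rule J(2))
    have 2: "J \<subseteq> B (N J)" using J un by (intro N) auto
    have "P J = distr (distr (Q n) (config_measure (B (N J))) (\<lambda>\<sigma>. restrict \<sigma> (B (N J))))
        (PiM J (\<lambda>_. borel)) (\<lambda>\<sigma>. restrict \<sigma> J)"
      by (simp add: P_def cons'[OF 1])
    also have "\<dots> = distr (Q n) (PiM J (\<lambda>_. borel)) (\<lambda>\<sigma>. restrict \<sigma> J)"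
      using le[OF 1] 2
      by (subst distr_distr)
        (auto simp: meas_Q comp_def Int_absorb1 intro!: measurable_restrict_config measurable_config_borel)
    finally show ?thesis .
  qed
  interpret P: polish_projective V P
  proof (intro polish_projective.intro projective_family.intro)
    fix J H :: "'v set" assume JH: "J \<subseteq> H" "finite H" "H \<subseteq> V"
    have H: "H \<subseteq> B (N H)" using JH by (intro N)
    have "distr (P H) (PiM J (\<lambda>_. borel)) (\<lambda>f. restrict f J)
        = distr (Q (N H)) (PiM J (\<lambda>_. borel)) (\<lambda>\<sigma>. restrict \<sigma> J)"
      unfolding P_def using H JH(1)
      by (subst distr_distr)
        (auto simp: meas_Q comp_def Int_absorb1 intro!: measurable_config_borel measurable_restrict_subset)
    also have "\<dots> = P J"
      using JH H by (intro P[symmetric]) (auto intro: finite_subset)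
    finally show "P J = distr (P H) (PiM J (\<lambda>_. borel)) (\<lambda>f. restrict f J)" ..
  next
    fix J :: "'v set" assume "finite J" "J \<subseteq> V"
    then show "prob_space (P J)"
      unfolding P_def using N by (intro prob_space.prob_space_distr prob) (auto simp: meas_Q intro!: measurable_config_borel)
  qed
  have lim: "distr P.lim (PiM J (\<lambda>_. borel)) (\<lambda>\<sigma>. restrict \<sigma> J) = P J" if "finite J" "J \<subseteq> V" for J
  proof (rule measure_eqI)
    fix X assume "X \<in> sets (distr P.lim (PiM J (\<lambda>_. borel)) (\<lambda>\<sigma>. restrict \<sigma> J))"
    then have X: "X \<in> sets (PiM J (\<lambda>_. borel))" by simp
    have "(\<lambda>\<sigma>. restrict \<sigma> J) \<in> P.lim \<rightarrow>\<^sub>M PiM J (\<lambda>_. borel)"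
      using measurable_restrict_subset[OF that(2)] by (simp add: measurable_cong_sets[OF P.sets_lim refl])
    then have "emeasure (distr P.lim (PiM J (\<lambda>_. borel)) (\<lambda>\<sigma>. restrict \<sigma> J)) X
        = emeasure P.lim (prod_emb V (\<lambda>_. borel) J X)"
      using X by (simp add: emeasure_distr prod_emb_def space_PiM)
    also have "\<dots> = emeasure (P J) X" using that X by (intro P.emeasure_lim_emb)
    finally show "emeasure (distr P.lim (PiM J (\<lambda>_. borel)) (\<lambda>\<sigma>. restrict \<sigma> J)) X = emeasure (P J) X" .
  qed (simp add: P_def)
  \<comment> \<open>Clipping acts coordinatewise, hence commutes with restriction, and it fixes
    configurations with values in [0,1]. It therefore leaves the marginals \<open>Q n\<close>
    unchanged.\<close>
  define c where "c A \<sigma> = (\<lambda>x\<in>A. ?clip (\<sigma> x))" for A :: "'v set" and \<sigma> :: "'v \<Rightarrow> real"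
  have meas_c: "c A \<in> PiM A (\<lambda>_. borel) \<rightarrow>\<^sub>M config_measure A" for A
    unfolding c_def config_measure_def
    by (intro measurable_restrict measurable_compose[OF _ measurable_clip] measurable_component_singleton)
  have meas_c': "c V \<in> P.lim \<rightarrow>\<^sub>M config_measure V"
    using meas_c[of V] by (simp add: measurable_cong_sets[OF P.sets_lim refl])
  show thesis
  proof
    show "prob_space (distr P.lim (config_measure V) (c V))"
      by (intro P.P.prob_space_distr meas_c')
    show "sets (distr P.lim (config_measure V) (c V)) = sets (config_measure V)" by simp
    fix n
    have BV: "B n \<subseteq> V" using un by blast
    have "distr (distr P.lim (config_measure V) (c V)) (config_measure (B n)) (\<lambda>\<sigma>. restrict \<sigma> (B n))
      = distr P.lim (config_measure (B n)) (\<lambda>\<sigma>. c (B n) (restrict \<sigma> (B n)))"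
      using BV by (subst distr_distr)
        (auto simp: c_def comp_def fun_eq_iff intro!: measurable_restrict_config meas_c' distr_cong)
    also have "\<dots> = distr (distr P.lim (PiM (B n) (\<lambda>_. borel)) (\<lambda>\<sigma>. restrict \<sigma> (B n)))
        (config_measure (B n)) (c (B n))"
      using measurable_restrict_subset[OF BV]
      by (subst distr_distr) (auto simp: comp_def meas_c measurable_cong_sets[OF P.sets_lim refl])
    also have "\<dots> = distr (distr (Q n) (PiM (B n) (\<lambda>_. borel)) (\<lambda>\<sigma>. restrict \<sigma> (B n)))
        (config_measure (B n)) (c (B n))"
      by (simp add: lim[OF fin BV] P[OF fin order_refl])
    also have "\<dots> = distr (Q n) (config_measure (B n)) (\<lambda>\<sigma>. c (B n) (restrict \<sigma> (B n)))"
      by (subst distr_distr) (auto simp: comp_def meas_c meas_Q intro!: measurable_config_borel)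
    also have "\<dots> = distr (Q n) (Q n) (\<lambda>\<sigma>. \<sigma>)"
    proof (rule distr_cong)
      fix \<sigma> assume "\<sigma> \<in> space (Q n)"
      then have "\<sigma> \<in> B n \<rightarrow>\<^sub>E {0..1}"
        using sets_eq_imp_space_eq[OF sets] by (simp add: space_config_measure)
      then show "c (B n) (restrict \<sigma> (B n)) = \<sigma>"
        by (fastforce simp: c_def PiE_iff extensional_def fun_eq_iff)
    qed (simp_all add: sets)
    also have "\<dots> = Q n" by (rule distr_id2) simp
    finally show "distr (distr P.lim (config_measure V) (c V)) (config_measure (B n))
        (\<lambda>\<sigma>. restrict \<sigma> (B n)) = Q n" .
  qed
qed

section \<open>Integration and almost-everywhere statements over configurations\<close>

lemma continuous_on_unit_measurable:
  "continuous_on {0..1} f \<Longrightarrow> f \<in> borel_measurable unit_measure"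
  by (subst measurable_cong_sets[OF sets_unit_measure refl])
    (rule borel_measurable_continuous_on_restrict)

lemma continuous_on_bounded_abs:
  fixes f :: "'a::topological_space \<Rightarrow> real"
  assumes "compact S" "continuous_on S f"
  obtains b where "\<And>x. x \<in> S \<Longrightarrow> \<bar>f x\<bar> \<le> b"
proof -
  have "bounded (f ` S)"
    using compact_continuous_image[OF assms(2,1)] by (rule compact_imp_bounded)
  then obtain b where "\<forall>y\<in>f ` S. norm y \<le> b" unfolding bounded_iff by blast
  then show thesis by (intro that[of b]) simp
qed

lemma integrable_unit_measure:
  fixes f :: "real \<Rightarrow> real"
  assumes "continuous_on {0..1} f"
  shows "integrable unit_measure f"
proof -
  obtain b where "\<And>t. t \<in> {0..1} \<Longrightarrow> \<bar>f t\<bar> \<le> b"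
    using continuous_on_bounded_abs[OF compact_Icc assms] by blast
  then show ?thesis
    by (intro unit_measure.integrable_const_bound[of _ b] continuous_on_unit_measurable assms AE_I2) simp
qed

lemma measurable_config_eval:
  "x \<in> A \<Longrightarrow> (\<lambda>\<sigma>. \<sigma> x) \<in> config_measure A \<rightarrow>\<^sub>M unit_measure"
  unfolding config_measure_def by (rule measurable_component_singleton)

lemma config_eval_in_unit:
  "\<sigma> \<in> space (config_measure A) \<Longrightarrow> x \<in> A \<Longrightarrow> 0 \<le> \<sigma> x \<and> \<sigma> x \<le> 1"
  by (auto simp: space_config_measure PiE_iff)

text \<open>A box with sides of positive measure has positive product measure and so does not fit
  into a null set. It serves to realise an almost-everywhere identity at configurations whose spins
  are all small, or all large.\<close>

lemma AE_config_measure_box: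
  assumes "finite A" "J \<subseteq> {0..1}" "J \<in> sets borel" "emeasure lborel J > 0" "AE \<sigma> in config_measure A. P \<sigma>"
  obtains \<sigma> where "\<sigma> \<in> A \<rightarrow>\<^sub>E J" "P \<sigma>"
proof -
  have J: "J \<in> sets unit_measure" using assms(2,3)
    by (simp add: unit_measure_def sets_restrict_space_iff)
  have "emeasure (config_measure A) (A \<rightarrow>\<^sub>E J) = (\<Prod>x\<in>A. emeasure unit_measure J)"
    unfolding config_measure_def by (intro unit_product.emeasure_PiM assms(1) J)
  also have "emeasure unit_measure J = emeasure lborel J"
    unfolding unit_measure_def using assms(2) by (intro emeasure_restrict_space) auto
  finally have "emeasure (config_measure A) (A \<rightarrow>\<^sub>E J) \<noteq> 0"
    using assms(1,4) by auto
  moreover have "emeasure (config_measure A) (A \<rightarrow>\<^sub>E J) = 0" if "\<forall>\<sigma>\<in>A \<rightarrow>\<^sub>E J. \<not> P \<sigma>"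
  proof -
    have "A \<rightarrow>\<^sub>E J \<in> sets (config_measure A)"
      unfolding config_measure_def by (intro sets_PiM_I_finite assms(1) J)
    moreover have "AE \<sigma> in config_measure A. \<sigma> \<notin> A \<rightarrow>\<^sub>E J"
      using assms(5) that by (auto elim: eventually_mono)
    ultimately show ?thesis
      by (simp add: AE_iff_measurable[OF _ refl] sets.sets_into_space Collect_conj_eq
          Int_absorb1 del: PiE_iff)
  qed
  ultimately show thesis using that by blast
qed

section \<open>Existence of splitting Gibbs measures\<close>

text \<open>\<open>boundary_eq\<close> is the boundary law up to a constant that may depend on
  \<open>y\<close>; these constants are absorbed by the partition functions. It is imposed away from
  the root because compatibility starts at n = 2, where the spins integrated out are successors of
  vertices of a sphere of radius at least 1.\<close>

locale splitting_boundary = rooted_cayley_tree V L x0 k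
  for V :: "'v set" and L :: "'v set set" and x0 :: 'v and k :: nat +
  fixes \<beta> :: real and \<phi> :: "real \<Rightarrow> real \<Rightarrow> real" and h :: "real \<Rightarrow> 'v \<Rightarrow> real"
  assumes interaction_cont: "continuous_on ({0..1} \<times> {0..1}) (\<lambda>(s, t). \<phi> s t)"
    and boundary_cont: "x \<in> V - {x0} \<Longrightarrow> continuous_on {0..1} (\<lambda>t. h t x)"
    and boundary_eq: "y \<in> V - {x0} \<Longrightarrow> \<exists>C. \<forall>t\<in>{0..1}.
      (\<Prod>x\<in>children y. \<integral>s. exp (- \<beta> * \<phi> s t + h s x) \<partial>unit_measure) = C * exp (h t y)"
begin

abbreviation "weight \<equiv> gibbs_weight V L x0 \<beta> \<phi> h"
abbreviation "dens \<equiv> gibbs_density V L x0 \<beta> \<phi> h"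
abbreviation "Z \<equiv> partition_fn V L x0 \<beta> \<phi> h"

lemma sphere_Suc_nonroot: "tree_sphere (Suc n) \<subseteq> V - {x0}"
  by (auto simp: sphere_at_def)

lemma sphereD:
  assumes "x \<in> tree_sphere (Suc n)"
  shows "x \<in> tree_ball (Suc n)" "x \<in> V - {x0}"
  using assms sphere_subset_ball[of "Suc n"] sphere_Suc_nonroot[of n] by auto

lemma weight_parent:
  "weight n \<sigma> = exp (- \<beta> * (\<Sum>x\<in>tree_ball n - {x0}. \<phi> (\<sigma> x) (\<sigma> (parent x)))
     + (\<Sum>x\<in>tree_sphere n. h (\<sigma> x) x))"
  by (simp add: gibbs_weight_def hamiltonian_eq_sum_parent)

text \<open>Since \<open>\<phi>\<close> is continuous on the unit square only, a pair of spins is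
  treated as a map into the Borel space restricted to that square. Radii have the form
  \<open>Suc n\<close> because the sphere of radius 0 is the root, where nothing is assumed about
  \<open>h\<close>.\<close>

lemma weight_measurable: "weight (Suc n) \<in> borel_measurable (config_measure (tree_ball (Suc n)))"
proof -
  let ?A = "tree_ball (Suc n)"
  have "(\<lambda>\<sigma>. \<phi> (\<sigma> x) (\<sigma> (parent x))) \<in> borel_measurable (config_measure ?A)"
    if x: "x \<in> ?A - {x0}" for x
  proof -
    have *: "(\<lambda>\<sigma>. \<sigma> y) \<in> borel_measurable (config_measure ?A)" if "y \<in> ?A" for y
      using measurable_compose[OF measurable_config_eval[OF that] measurable_unit_measure_ident] .
    have "(\<lambda>\<sigma>. (\<sigma> x, \<sigma> (parent x))) \<in> config_measure ?A \<rightarrow>\<^sub>M restrict_space borel ({0..1} \<times> {0..1})"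
      using x parent_in_ball[OF x]
      by (intro measurable_restrict_space2 borel_measurable_Pair *)
        (auto dest: config_eval_in_unit)
    from measurable_compose[OF this borel_measurable_continuous_on_restrict[OF interaction_cont]]
    show ?thesis by simp
  qed
  moreover have "(\<lambda>\<sigma>. h (\<sigma> x) x) \<in> borel_measurable (config_measure ?A)"
    if x: "x \<in> tree_sphere (Suc n)" for x
    using sphereD[OF x]
    by (intro measurable_compose[OF measurable_config_eval continuous_on_unit_measurable] boundary_cont)
  ultimately show ?thesis
    unfolding weight_parent
    by (intro borel_measurable_exp[THEN measurable_compose[rotated]] borel_measurable_add
        borel_measurable_times borel_measurable_const borel_measurable_sum)
qed

text \<open>By compactness both parts of the exponent are bounded, and the configuration space has
  total mass 1.\<close>

lemma weight_integrable: "integrable (config_measure (tree_ball (Suc n))) (weight (Suc n))"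
proof -
  interpret C: prob_space "config_measure (tree_ball (Suc n))" by (rule prob_space_config_measure)
  obtain b where b: "\<And>z. z \<in> {0..1} \<times> {0..1} \<Longrightarrow> \<bar>case z of (s, t) \<Rightarrow> \<phi> s t\<bar> \<le> b"
    using continuous_on_bounded_abs[OF compact_Times[OF compact_Icc compact_Icc] interaction_cont] by blast
  have "\<exists>c. \<forall>t\<in>{0..1}. \<bar>h t x\<bar> \<le> c" if "x \<in> V - {x0}" for x
    using continuous_on_bounded_abs[OF compact_Icc boundary_cont[OF that]] by metis
  then obtain c where c: "\<And>x t. x \<in> V - {x0} \<Longrightarrow> t \<in> {0..1} \<Longrightarrow> \<bar>h t x\<bar> \<le> c x"
    by metis
  define S where "S = \<bar>\<beta>\<bar> * (\<Sum>x\<in>tree_ball (Suc n) - {x0}. b) + (\<Sum>x\<in>tree_sphere (Suc n). c x)"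
  have "norm (weight (Suc n) \<sigma>) \<le> exp S" if \<sigma>: "\<sigma> \<in> space (config_measure (tree_ball (Suc n)))" for \<sigma>
  proof -
    have 1: "\<bar>\<Sum>x\<in>tree_ball (Suc n) - {x0}. \<phi> (\<sigma> x) (\<sigma> (parent x))\<bar> \<le> (\<Sum>x\<in>tree_ball (Suc n) - {x0}. b)"
      (is "\<bar>?H\<bar> \<le> ?m")
    proof (rule order_trans[OF sum_abs sum_mono])
      fix x assume x: "x \<in> tree_ball (Suc n) - {x0}"
      then show "\<bar>\<phi> (\<sigma> x) (\<sigma> (parent x))\<bar> \<le> b"
        using b[of "(\<sigma> x, \<sigma> (parent x))"] parent_in_ball[OF x] config_eval_in_unit[OF \<sigma>] by simp
    qed
    have 2: "(\<Sum>x\<in>tree_sphere (Suc n). h (\<sigma> x) x) \<le> (\<Sum>x\<in>tree_sphere (Suc n). c x)"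
    proof (rule sum_mono)
      fix x assume x: "x \<in> tree_sphere (Suc n)"
      have "\<bar>h (\<sigma> x) x\<bar> \<le> c x"
        using config_eval_in_unit[OF \<sigma> sphereD(1)[OF x]] by (intro c sphereD(2)[OF x]) simp
      then show "h (\<sigma> x) x \<le> c x" by simp
    qed
    have "- \<beta> * ?H \<le> \<bar>- \<beta> * ?H\<bar>" by (rule abs_ge_self)
    also have "\<dots> = \<bar>\<beta>\<bar> * \<bar>?H\<bar>" unfolding abs_mult by simp
    also have "\<dots> \<le> \<bar>\<beta>\<bar> * ?m" by (intro mult_left_mono 1) simp
    finally have "- \<beta> * ?H + (\<Sum>x\<in>tree_sphere (Suc n). h (\<sigma> x) x) \<le> S"
      unfolding S_def using 2 by (rule add_mono)
    then show ?thesis unfolding weight_parent by simp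
  qed
  then show ?thesis
    by (intro C.integrable_const_bound[of _ "exp S"] weight_measurable AE_I2)
qed

lemma Z_pos: "Z (Suc n) > 0"
proof -
  interpret C: prob_space "config_measure (tree_ball (Suc n))" by (rule prob_space_config_measure)
  have "(\<integral>\<sigma>. 0 \<partial>config_measure (tree_ball (Suc n))) < Z (Suc n)"
    unfolding partition_fn_def
    by (rule C.integral_less_AE_space)
      (simp_all add: weight_integrable C.emeasure_space_1, simp add: gibbs_weight_def)
  then show ?thesis by simp
qed

lemma dens_pos: "dens (Suc n) \<sigma> > 0"
  using Z_pos[of n] by (simp add: gibbs_density_def gibbs_weight_def)

lemma dens_measurable: "dens (Suc n) \<in> borel_measurable (config_measure (tree_ball (Suc n)))"
  unfolding gibbs_density_def by (intro borel_measurable_divide weight_measurable borel_measurable_const)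

lemma dens_integral:
  shows "integrable (config_measure (tree_ball (Suc n))) (dens (Suc n))"
    and "(\<integral>\<sigma>. dens (Suc n) \<sigma> \<partial>config_measure (tree_ball (Suc n))) = 1"
proof -
  show "integrable (config_measure (tree_ball (Suc n))) (dens (Suc n))"
    unfolding gibbs_density_def by (intro integrable_divide weight_integrable)
  show "(\<integral>\<sigma>. dens (Suc n) \<sigma> \<partial>config_measure (tree_ball (Suc n))) = 1"
    unfolding gibbs_density_def using Z_pos[of n] by (simp flip: partition_fn_def)
qed

section \<open>Consistency of the finite-volume densities\<close>

lemma weight_merge:
  fixes \<sigma> \<omega> :: "'v \<Rightarrow> real" and n :: nat
  defines "\<tau> \<equiv> merge (tree_ball n) (tree_sphere (Suc n)) (\<sigma>, \<omega>)"
  shows "weight (Suc n) \<tau> = exp (- \<beta> * hamiltonian L x0 \<phi> (tree_ball n) \<sigma>)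
    * (\<Prod>x\<in>tree_sphere (Suc n). exp (- \<beta> * \<phi> (\<omega> x) (\<sigma> (parent x)) + h (\<omega> x) x))"
proof -
  note disj = ball_sphere_disjoint[of n]
  have b: "\<tau> x = \<sigma> x" if "x \<in> tree_ball n" for x
    using that disj by (simp add: \<tau>_def)
  have s: "\<tau> x = \<omega> x" if "x \<in> tree_sphere (Suc n)" for x
    using that disj by (simp add: \<tau>_def)
  \<comment> \<open>Indexed by farther endpoints, the edges added by the new sphere are those to the
    parents. Each joins one new spin to an old one, so the weight becomes a product of functions of
    single new spins.\<close>
  have "tree_ball (Suc n) - {x0} = (tree_ball n - {x0}) \<union> tree_sphere (Suc n)"
    using sphere_Suc_nonroot by (auto simp: ball_Suc)
  then have "(\<Sum>x\<in>tree_ball (Suc n) - {x0}. \<phi> (\<tau> x) (\<tau> (parent x)))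
    = (\<Sum>x\<in>tree_ball n - {x0}. \<phi> (\<tau> x) (\<tau> (parent x)))
      + (\<Sum>x\<in>tree_sphere (Suc n). \<phi> (\<tau> x) (\<tau> (parent x)))"
    using disj finite_ball finite_sphere by (simp add: sum.union_disjoint Diff_Int_distrib2)
  also have "(\<Sum>x\<in>tree_ball n - {x0}. \<phi> (\<tau> x) (\<tau> (parent x)))
    = (\<Sum>x\<in>tree_ball n - {x0}. \<phi> (\<sigma> x) (\<sigma> (parent x)))"
    using parent_in_ball by (intro sum.cong) (simp_all add: b)
  also have "(\<Sum>x\<in>tree_sphere (Suc n). \<phi> (\<tau> x) (\<tau> (parent x)))
    = (\<Sum>x\<in>tree_sphere (Suc n). \<phi> (\<omega> x) (\<sigma> (parent x)))"
    by (intro sum.cong) (simp_all add: b s subsetD[OF sphere_subset_ball parent_in_sphere])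
  finally have H: "(\<Sum>x\<in>tree_ball (Suc n) - {x0}. \<phi> (\<tau> x) (\<tau> (parent x)))
    = (\<Sum>x\<in>tree_ball n - {x0}. \<phi> (\<sigma> x) (\<sigma> (parent x)))
      + (\<Sum>x\<in>tree_sphere (Suc n). \<phi> (\<omega> x) (\<sigma> (parent x)))" .
  have "(\<Sum>x\<in>tree_sphere (Suc n). h (\<tau> x) x) = (\<Sum>x\<in>tree_sphere (Suc n). h (\<omega> x) x)"
    by (intro sum.cong) (simp_all add: s)
  moreover have "(\<Prod>x\<in>tree_sphere (Suc n). exp (- \<beta> * \<phi> (\<omega> x) (\<sigma> (parent x)) + h (\<omega> x) x))
    = exp (- \<beta> * (\<Sum>x\<in>tree_sphere (Suc n). \<phi> (\<omega> x) (\<sigma> (parent x)))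
        + (\<Sum>x\<in>tree_sphere (Suc n). h (\<omega> x) x))"
    unfolding exp_sum[OF finite_sphere, symmetric] sum.distrib sum_distrib_left ..
  ultimately show ?thesis
    unfolding weight_parent hamiltonian_eq_sum_parent H by (simp add: distrib_left flip: exp_add)
qed

lemma kernel_integrable:
  assumes "t \<in> {0..1}" "x \<in> V - {x0}"
  shows "integrable unit_measure (\<lambda>s. exp (- \<beta> * \<phi> s t + h s x))"
proof -
  have "continuous_on {0..1} (\<lambda>s. (\<lambda>(s, t). \<phi> s t) (s, t))"
    using assms(1) by (intro continuous_on_compose2[OF interaction_cont] continuous_intros) auto
  then show ?thesis
    using assms(2) by (intro integrable_unit_measure continuous_intros boundary_cont) simp
qed

text \<open>Given the inner spins, the new spins are independent: the integral over the sphere is a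
  product of one-spin integrals, regrouped by parent.\<close>

lemma weight_merge_integral:
  assumes "\<sigma> \<in> space (config_measure (tree_ball n))"
  shows "integrable (config_measure (tree_sphere (Suc n)))
      (\<lambda>\<omega>. weight (Suc n) (merge (tree_ball n) (tree_sphere (Suc n)) (\<sigma>, \<omega>)))" (is ?int)
    and "(\<integral>\<omega>. weight (Suc n) (merge (tree_ball n) (tree_sphere (Suc n)) (\<sigma>, \<omega>))
        \<partial>config_measure (tree_sphere (Suc n)))
      = exp (- \<beta> * hamiltonian L x0 \<phi> (tree_ball n) \<sigma>) *
        (\<Prod>y\<in>tree_sphere n. \<Prod>x\<in>children y. \<integral>s. exp (- \<beta> * \<phi> s (\<sigma> y) + h s x) \<partial>unit_measure)" (is ?eq)
proof -
  have int: "integrable unit_measure (\<lambda>s. exp (- \<beta> * \<phi> s (\<sigma> (parent x)) + h s x))"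
    if x: "x \<in> tree_sphere (Suc n)" for x
  proof (rule kernel_integrable)
    have "parent x \<in> tree_ball n" using parent_in_sphere[OF x] sphere_subset_ball by blast
    then show "\<sigma> (parent x) \<in> {0..1}" using config_eval_in_unit[OF assms] by simp
    show "x \<in> V - {x0}" using x by (rule sphereD)
  qed
  note * = finite_sphere int
  show ?int unfolding weight_merge config_measure_def
    by (intro integrable_mult_right unit_product.product_integrable_prod *)
  show ?eq unfolding weight_merge config_measure_def
    using unit_product.product_integral_prod[OF *]
      prod_sphere_Suc[of "\<lambda>x y. \<integral>s. exp (- \<beta> * \<phi> s (\<sigma> y) + h s x) \<partial>unit_measure"]
    by simp
qed

text \<open>The boundary law turns the product over the successors of \<open>y\<close> into a
  constant times \<open>exp (h (\<sigma> y) y)\<close>, and these exponentials are exactly the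
  boundary term of the smaller ball.\<close>

lemma weight_consistent:
  "\<exists>C. \<forall>\<sigma>\<in>space (config_measure (tree_ball (Suc n))).
    (\<integral>\<omega>. weight (Suc (Suc n)) (merge (tree_ball (Suc n)) (tree_sphere (Suc (Suc n))) (\<sigma>, \<omega>))
        \<partial>config_measure (tree_sphere (Suc (Suc n)))) = C * weight (Suc n) \<sigma>"
proof -
  have "\<forall>y\<in>V - {x0}. \<exists>C. \<forall>t\<in>{0..1}.
      (\<Prod>x\<in>children y. \<integral>s. exp (- \<beta> * \<phi> s t + h s x) \<partial>unit_measure) = C * exp (h t y)"
    using boundary_eq ..
  from bchoice[OF this] obtain C where C: "y \<in> V - {x0} \<Longrightarrow> t \<in> {0..1} \<Longrightarrow>
      (\<Prod>x\<in>children y. \<integral>s. exp (- \<beta> * \<phi> s t + h s x) \<partial>unit_measure) = C y * exp (h t y)" for y t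
    by blast
  have "(\<integral>\<omega>. weight (Suc (Suc n)) (merge (tree_ball (Suc n)) (tree_sphere (Suc (Suc n))) (\<sigma>, \<omega>))
        \<partial>config_measure (tree_sphere (Suc (Suc n)))) = (\<Prod>y\<in>tree_sphere (Suc n). C y) * weight (Suc n) \<sigma>"
    if \<sigma>: "\<sigma> \<in> space (config_measure (tree_ball (Suc n)))" for \<sigma>
  proof -
    have "(\<Prod>y\<in>tree_sphere (Suc n). \<Prod>x\<in>children y.
        \<integral>s. exp (- \<beta> * \<phi> s (\<sigma> y) + h s x) \<partial>unit_measure)
      = (\<Prod>y\<in>tree_sphere (Suc n). C y * exp (h (\<sigma> y) y))"
    proof (intro prod.cong C refl)
      fix y assume y: "y \<in> tree_sphere (Suc n)"
      then show "y \<in> V - {x0}" by (rule sphereD)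
      show "\<sigma> y \<in> {0..1}" using config_eval_in_unit[OF \<sigma> sphereD(1)[OF y]] by simp
    qed
    moreover have "weight (Suc n) \<sigma> = exp (- \<beta> * hamiltonian L x0 \<phi> (tree_ball (Suc n)) \<sigma>)
        * (\<Prod>y\<in>tree_sphere (Suc n). exp (h (\<sigma> y) y))"
      unfolding gibbs_weight_def exp_add exp_sum[OF finite_sphere] ..
    ultimately show ?thesis
      unfolding weight_merge_integral(2)[OF \<sigma>] by (simp only: prod.distrib mult_ac)
  qed
  then show ?thesis by blast
qed

text \<open>The constant of \<open>weight_consistent\<close> is identified by integrating over the
  inner ball as well: it is the quotient of consecutive partition functions, which is what the
  normalization divides out.\<close>

lemma dens_consistent:
  assumes \<sigma>: "\<sigma> \<in> space (config_measure (tree_ball (Suc n)))"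
  shows "(\<integral>\<omega>. dens (Suc (Suc n)) (merge (tree_ball (Suc n)) (tree_sphere (Suc (Suc n))) (\<sigma>, \<omega>))
        \<partial>config_measure (tree_sphere (Suc (Suc n)))) = dens (Suc n) \<sigma>"
proof -
  obtain C where C: "\<And>\<sigma>. \<sigma> \<in> space (config_measure (tree_ball (Suc n))) \<Longrightarrow>
    (\<integral>\<omega>. weight (Suc (Suc n)) (merge (tree_ball (Suc n)) (tree_sphere (Suc (Suc n))) (\<sigma>, \<omega>))
        \<partial>config_measure (tree_sphere (Suc (Suc n)))) = C * weight (Suc n) \<sigma>"
    using weight_consistent by blast
  have "Z (Suc (Suc n)) = (\<integral>\<sigma>. \<integral>\<omega>. weight (Suc (Suc n))
      (merge (tree_ball (Suc n)) (tree_sphere (Suc (Suc n))) (\<sigma>, \<omega>))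
      \<partial>config_measure (tree_sphere (Suc (Suc n))) \<partial>config_measure (tree_ball (Suc n)))"
    using weight_integrable[of "Suc n"]
    unfolding partition_fn_def config_measure_def ball_Suc[of "Suc n"]
    by (intro unit_product.product_integral_fold ball_sphere_disjoint finite_ball finite_sphere)
  also have "\<dots> = (\<integral>\<sigma>. C * weight (Suc n) \<sigma> \<partial>config_measure (tree_ball (Suc n)))"
    by (intro Bochner_Integration.integral_cong refl C)
  also have "\<dots> = C * Z (Suc n)" by (simp add: partition_fn_def)
  finally have Z: "Z (Suc (Suc n)) = C * Z (Suc n)" .
  then have "C \<noteq> 0" using Z_pos[of "Suc n"] by auto
  with Z show ?thesis
    using C[OF \<sigma>] Z_pos[of n] by (simp add: gibbs_density_def)
qed

text \<open>This is \<open>dens_consistent\<close> restated for measures. The indicator of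
  \<open>X\<close> depends on the inner spins alone and leaves the inner integral; positivity of the
  density passes from Bochner to nonnegative integrals.\<close>

lemma dens_marginal:
  "distr (density (config_measure (tree_ball (Suc (Suc n)))) (\<lambda>\<sigma>. ennreal (dens (Suc (Suc n)) \<sigma>)))
     (config_measure (tree_ball (Suc n))) (\<lambda>\<sigma>. restrict \<sigma> (tree_ball (Suc n)))
   = density (config_measure (tree_ball (Suc n))) (\<lambda>\<sigma>. ennreal (dens (Suc n) \<sigma>))"
proof (rule measure_eqI)
  let ?A = "tree_ball (Suc n)" and ?W = "tree_sphere (Suc (Suc n))" and ?B = "tree_ball (Suc (Suc n))"
  let ?d = "dens (Suc (Suc n))"
  have B: "?B = ?A \<union> ?W" by (rule ball_Suc)
  have disj: "?A \<inter> ?W = {}" by (rule ball_sphere_disjoint)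
  fix X assume "X \<in> sets (distr (density (config_measure ?B) (\<lambda>\<sigma>. ennreal (?d \<sigma>)))
     (config_measure ?A) (\<lambda>\<sigma>. restrict \<sigma> ?A))"
  then have X: "X \<in> sets (config_measure ?A)" by simp
  have r: "(\<lambda>\<sigma>. restrict \<sigma> ?A) \<in> config_measure ?B \<rightarrow>\<^sub>M config_measure ?A"
    by (rule measurable_restrict_config) (simp add: B)
  note [measurable] = dens_measurable r X
  have "emeasure (distr (density (config_measure ?B) (\<lambda>\<sigma>. ennreal (?d \<sigma>)))
     (config_measure ?A) (\<lambda>\<sigma>. restrict \<sigma> ?A)) X
    = (\<integral>\<^sup>+\<sigma>. ennreal (?d \<sigma>) * indicator X (restrict \<sigma> ?A) \<partial>config_measure ?B)"
    by (subst emeasure_distr)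
      (auto simp: emeasure_density measurable_sets[OF r X] split: split_indicator intro!: nn_integral_cong)
  also have "\<dots> = (\<integral>\<^sup>+\<sigma>. \<integral>\<^sup>+\<omega>. ennreal (?d (merge ?A ?W (\<sigma>, \<omega>)))
      * indicator X (restrict (merge ?A ?W (\<sigma>, \<omega>)) ?A) \<partial>config_measure ?W \<partial>config_measure ?A)"
  proof -
    have "(\<lambda>\<sigma>. ennreal (?d \<sigma>) * indicator X (restrict \<sigma> ?A)) \<in> borel_measurable (config_measure ?B)"
      by measurable
    then show ?thesis
      unfolding config_measure_def B
      by (intro unit_product.product_nn_integral_fold disj finite_ball finite_sphere)
  qed
  also have "\<dots> = (\<integral>\<^sup>+\<sigma>. ennreal (dens (Suc n) \<sigma>) * indicator X \<sigma> \<partial>config_measure ?A)"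
  proof (rule nn_integral_cong)
    fix \<sigma> assume \<sigma>: "\<sigma> \<in> space (config_measure ?A)"
    have "restrict (merge ?A ?W (\<sigma>, \<omega>)) ?A = \<sigma>" for \<omega>
      using \<sigma> disj by (auto simp: space_config_measure PiE_iff extensional_def fun_eq_iff)
    moreover have i: "integrable (config_measure ?W) (\<lambda>\<omega>. ?d (merge ?A ?W (\<sigma>, \<omega>)))"
      unfolding gibbs_density_def by (intro integrable_divide weight_merge_integral(1) \<sigma>)
    moreover have "(\<integral>\<^sup>+\<omega>. ennreal (?d (merge ?A ?W (\<sigma>, \<omega>))) \<partial>config_measure ?W) = ennreal (dens (Suc n) \<sigma>)"
      using dens_pos[of "Suc n"] dens_consistent[OF \<sigma>] i
      by (subst nn_integral_eq_integral) (auto intro: less_imp_le)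
    ultimately show "(\<integral>\<^sup>+\<omega>. ennreal (?d (merge ?A ?W (\<sigma>, \<omega>)))
        * indicator X (restrict (merge ?A ?W (\<sigma>, \<omega>)) ?A) \<partial>config_measure ?W)
      = ennreal (dens (Suc n) \<sigma>) * indicator X \<sigma>"
      by (simp add: nn_integral_multc borel_measurable_integrable)
  qed
  also have "\<dots> = emeasure (density (config_measure ?A) (\<lambda>\<sigma>. ennreal (dens (Suc n) \<sigma>))) X"
    by (simp add: emeasure_density)
  finally show "emeasure (distr (density (config_measure ?B) (\<lambda>\<sigma>. ennreal (?d \<sigma>)))
     (config_measure ?A) (\<lambda>\<sigma>. restrict \<sigma> ?A)) X
    = emeasure (density (config_measure ?A) (\<lambda>\<sigma>. ennreal (dens (Suc n) \<sigma>))) X" .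
qed simp

theorem splitting_gibbs_measure_exists:
  "\<exists>\<mu>. splitting_gibbs_measure V L x0 \<beta> \<phi> h \<mu>"
proof -
  let ?Q = "\<lambda>n. density (config_measure (tree_ball (Suc n))) (\<lambda>\<sigma>. ennreal (dens (Suc n) \<sigma>))"
  have prob: "prob_space (?Q n)" for n
  proof
    have "emeasure (?Q n) (space (?Q n))
      = (\<integral>\<^sup>+\<sigma>. ennreal (dens (Suc n) \<sigma>) \<partial>config_measure (tree_ball (Suc n)))"
      using dens_measurable by (auto simp: emeasure_density intro!: nn_integral_cong)
    also have "\<dots> = 1"
      using dens_integral[of n] dens_pos[of n]
      by (subst nn_integral_eq_integral) (auto intro: less_imp_le)
    finally show "emeasure (?Q n) (space (?Q n)) = 1" .
  qed
  have mono: "tree_ball (Suc n) \<subseteq> tree_ball (Suc (Suc n))" for n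
    by (simp add: ball_Suc[of "Suc n"])
  obtain \<mu> where \<mu>: "prob_space \<mu>" "sets \<mu> = sets (config_measure V)"
    "\<And>n. distr \<mu> (config_measure (tree_ball (Suc n))) (\<lambda>\<sigma>. restrict \<sigma> (tree_ball (Suc n))) = ?Q n"
    by (rule config_projective_limit[where B = "\<lambda>n. tree_ball (Suc n)" and Q = ?Q and V = V,
          OF finite_ball mono Union_ball prob _ dens_marginal]) (simp, blast)
  have Suc: "\<exists>m. n = Suc m" if "n \<ge> 1" for n :: nat using that by (cases n) auto
  have "gibbs_normalizable V L x0 \<beta> \<phi> h"
    unfolding gibbs_normalizable_def
  proof (intro allI impI)
    fix n :: nat assume "n \<ge> 1"
    then obtain m where "n = Suc m" using Suc by blast
    then show "integrable (config_measure (tree_ball n)) (weight n)"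
      by (simp add: weight_integrable)
  qed
  moreover have "gibbs_compatible V L x0 \<beta> \<phi> h"
    unfolding gibbs_compatible_def
  proof (intro allI impI ballI)
    fix n :: nat and \<sigma> :: "'v \<Rightarrow> real"
    assume "2 \<le> n" and \<sigma>: "\<sigma> \<in> tree_ball (n - 1) \<rightarrow>\<^sub>E {0..1}"
    then obtain m where n: "n = Suc (Suc m)" using Suc[of n] Suc[of "n - 1"] by force
    from \<sigma> show "(\<integral>\<omega>. dens n (merge (tree_ball (n - 1)) (tree_sphere n) (\<sigma>, \<omega>))
        \<partial>config_measure (tree_sphere n)) = dens (n - 1) \<sigma>"
      using dens_consistent[of \<sigma> m] by (simp add: n space_config_measure)
  qed
  moreover have "distr \<mu> (config_measure (tree_ball n)) (\<lambda>\<sigma>. restrict \<sigma> (tree_ball n))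
      = density (config_measure (tree_ball n)) (\<lambda>\<sigma>. ennreal (dens n \<sigma>))" if "n \<ge> 1" for n
    using Suc[OF that] \<mu>(3) by auto
  ultimately show ?thesis
    using \<mu>(1,2) unfolding splitting_gibbs_measure_def by blast
qed

end

section \<open>The alternating boundary laws\<close>

text \<open>\<open>B - A\<close> is the denominator of c_k, and it is negative. The bound 4 amounts
  to \<open>B - A < - A / 4\<close>, where the strictness comes from \<open>p > 0\<close>.\<close>

lemma coupling_const_identity:
  assumes "k \<ge> 4"
  defines "A \<equiv> 2 * (1 - (1/3::real) ^ (k - 1))"
    and "B \<equiv> (real k - 1) / (real k - 2) * (1 - (1/3::real) ^ (k - 2))"
  shows "coupling_const k * (B - A) = A" "\<bar>coupling_const k\<bar> < 4"
proof -
  define p where "p = (1/3::real) ^ (k - 1)"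
  have "k - 1 = Suc (k - 2)" using assms(1) by simp
  then have q: "(1/3::real) ^ (k - 2) = 3 * p" by (simp add: p_def)
  have "p \<le> (1/3) ^ 3" unfolding p_def using assms(1) by (intro power_decreasing) auto
  then have p: "0 < p" "p \<le> 1/27" by (simp_all add: p_def power3_eq_cube)
  have A: "A = 2 * (1 - p)" by (simp add: A_def p_def)
  \<comment> \<open>The fraction is 1 + 1/(k - 2), which decreases in k and equals 3/2 at k =
    4.\<close>
  have "(real k - 1) / (real k - 2) \<le> 3/2" using assms(1) by (simp add: field_simps)
  then have "B \<le> 3/2 * (1 - 3 * p)" unfolding B_def q using p by (intro mult_right_mono) auto
  then have D: "B - A < - A / 4" "A > 0" using p by (simp_all add: A)
  have c: "coupling_const k = A / (B - A)"
    by (simp add: coupling_const_def A_def B_def)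
  show "coupling_const k * (B - A) = A" unfolding c using D by simp
  have "\<bar>coupling_const k\<bar> = A / (A - B)"
    unfolding c using D by (simp add: abs_divide abs_of_neg)
  also have "\<dots> < 4" using D by (simp add: pos_divide_less_eq)
  finally show "\<bar>coupling_const k\<bar> < 4" .
qed

text \<open>Centred spins have absolute value at most 1/2, so |c_k| < 4 suffices. This positivity is
  what allows \<open>exp\<close> to undo the logarithm in the interaction.\<close>

lemma interaction_numerator_pos:
  assumes "k \<ge> 4" "s \<in> {0..1}" "t \<in> {0..1}"
  shows "1 + coupling_const k * (s - 1/2) * (t - 1/2) > 0"
proof -
  have "\<bar>s - 1/2\<bar> \<le> 1/2" "\<bar>t - 1/2\<bar> \<le> 1/2"
    using assms unfolding atLeastAtMost_iff by linarith+
  then have "\<bar>s - 1/2\<bar> * \<bar>t - 1/2\<bar> \<le> 1/2 * (1/2)"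
    by (intro mult_mono) auto
  then have "\<bar>coupling_const k\<bar> * (\<bar>s - 1/2\<bar> * \<bar>t - 1/2\<bar>) \<le> \<bar>coupling_const k\<bar> * (1/4)"
    by (intro mult_left_mono) auto
  also have "\<dots> < 1" using coupling_const_identity(2)[OF assms(1)] by simp
  finally have "\<bar>coupling_const k * (s - 1/2) * (t - 1/2)\<bar> < 1"
    by (simp add: abs_mult mult.assoc)
  then show ?thesis by linarith
qed

lemma exp_model_interaction:
  assumes "k \<ge> 4" "a > 0" "\<beta> > 0" "s \<in> {0..1}" "t \<in> {0..1}"
  shows "exp (- \<beta> * model_interaction k a \<beta> s t)
    = (1 + coupling_const k * (s - 1/2) * (t - 1/2)) / (a ^ k * (s + 1/2) ^ k)"
  using interaction_numerator_pos[OF assms(1,4,5)] assms(2-4)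
  by (simp add: model_interaction_def)

lemma model_interaction_cont:
  assumes "k \<ge> 4" "a > 0"
  shows "continuous_on ({0..1} \<times> {0..1}) (\<lambda>(s, t). model_interaction k a \<beta> s t)"
proof -
  have "(1 + coupling_const k * (fst z - 1/2) * (snd z - 1/2)) / (a ^ k * (fst z + 1/2) ^ k) > 0"
    if "z \<in> {0..1} \<times> {0..1}" for z
    using that interaction_numerator_pos[OF assms(1), of "fst z" "snd z"] assms(2)
    by (intro divide_pos_pos mult_pos_pos zero_less_power) auto
  then show ?thesis
    unfolding model_interaction_def case_prod_beta
    by (intro continuous_intros) (use assms(2) in force)+
qed

section \<open>Integrals of the kernel\<close>

lemma unit_integral_FTC:
  fixes f F :: "real \<Rightarrow> real"
  assumes "\<And>x. 0 \<le> x \<Longrightarrow> x \<le> 1 \<Longrightarrow> DERIV F x :> f x"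
    and "\<And>x. 0 \<le> x \<Longrightarrow> x \<le> 1 \<Longrightarrow> isCont f x"
  shows "(\<integral>x. f x \<partial>unit_measure) = F 1 - F 0"
proof -
  have "(\<integral>x. f x \<partial>unit_measure) = (\<integral>x. f x * indicator {0..1} x \<partial>lborel)"
    unfolding unit_measure_def by (subst integral_restrict_space) (simp_all add: mult.commute)
  also have "\<dots> = F 1 - F 0" using assms by (intro integral_FTC_Icc_real) auto
  finally show ?thesis .
qed

text \<open>The antiderivative -u^(-m)/m is evaluated at u = 1/2 and u = 3/2, giving 2^m and
  (2/3)^m; this is the origin of the powers of 1/3 in c_k.\<close>

lemma unit_integral_inverse_power:
  assumes "m > 0"
  shows "(\<integral>s. 1 / (s + 1/2) ^ Suc m \<partial>unit_measure) = 2 ^ m * (1 - (1/3) ^ m) / real m"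
proof -
  have "(\<integral>s. 1 / (s + 1/2) ^ Suc m \<partial>unit_measure)
    = - (inverse (1 + 1/2) ^ m) / real m - - (inverse (0 + 1/2) ^ m) / real m"
  proof (rule unit_integral_FTC)
    fix x :: real assume x: "0 \<le> x" "x \<le> 1"
    have "DERIV (\<lambda>s. inverse (s + 1/2)) x :> - (inverse (x + 1/2) * inverse (x + 1/2))"
      using x by (auto intro!: derivative_eq_intros)
    from DERIV_cdivide[OF DERIV_minus[OF DERIV_power[OF this, of m]], of "real m"]
    have "DERIV (\<lambda>s. - (inverse (s + 1/2) ^ m) / real m) x :>
      inverse (x + 1/2) ^ m * inverse (x + 1/2)"
      using assms by (cases m) (simp_all add: mult_ac)
    then show "DERIV (\<lambda>s. - (inverse (s + 1/2) ^ m) / real m) x :> 1 / (x + 1/2) ^ Suc m"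
      by (simp add: inverse_eq_divide power_one_over mult.commute)
    show "isCont (\<lambda>s. 1 / (s + 1/2) ^ Suc m) x"
      using x by (intro continuous_intros) auto
  qed
  also have "\<dots> = 2 ^ m * (1 - (1/3) ^ m) / real m"
    using assms by (simp add: field_simps power_divide)
  finally show ?thesis .
qed

lemma kernel_integral_const:
  assumes "k \<ge> 4" "a > 0" "\<beta> > 0" "t \<in> {0..1}"
  defines "D \<equiv> 2 ^ (k - 2) * (1 - (1/3) ^ (k - 1)) / ((real k - 1) * a ^ k)"
  shows "(\<integral>s. exp (- \<beta> * model_interaction k a \<beta> s t) \<partial>unit_measure) = D * (2 * t + 1)"
proof -
  let ?c = "coupling_const k"
  define I where "I m = (\<integral>s. 1 / (s + 1/2) ^ m \<partial>unit_measure)" for m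
  have int: "integrable unit_measure (\<lambda>s. 1 / (s + 1/2) ^ m)" for m :: nat
    by (intro integrable_unit_measure continuous_intros) auto
  obtain m where k: "k = Suc (Suc m)" "m > 0"
    by (rule that[of "k - 2"]) (use assms(1) in simp_all)
  have I: "I k = 2 * 2 ^ m * (1 - (1/3) ^ Suc m) / (real m + 1)"
      "I (Suc m) = 2 ^ m * (1 - (1/3) ^ m) / real m"
    unfolding I_def k(1) using unit_integral_inverse_power[of "Suc m"]
      unit_integral_inverse_power[OF k(2)] by (simp_all add: add.commute)
  \<comment> \<open>Both integrals are the terms \<open>?B\<close> and \<open>?A\<close> of
    \<open>coupling_const_identity\<close>, multiplied by the same factor 2^m/(m + 1), so the
    homogeneous identity carries over.\<close>
  have c: "?c * (I (Suc m) - I k) = I k"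
  proof -
    let ?A = "2 * (1 - (1/3::real) ^ Suc m)" and ?B = "(real m + 1) / real m * (1 - (1/3::real) ^ m)"
    have BA: "?c * (?B - ?A) = ?A"
      using coupling_const_identity(1)[OF assms(1)] by (simp add: k(1) add.commute)
    have I_eq: "I k = 2 ^ m / (real m + 1) * ?A" "I (Suc m) = 2 ^ m / (real m + 1) * ?B"
      unfolding I using k(2) by (simp_all add: divide_simps)
    have scale: "c * (M * B - M * A) = M * A" if "c * (B - A) = A" for c A B M :: real
    proof -
      have "c * (M * B - M * A) = M * (c * (B - A))" by (simp add: algebra_simps)
      with that show ?thesis by simp
    qed
    show ?thesis unfolding I_eq by (rule scale[OF BA])
  qed
  \<comment> \<open>In u = s + 1/2 the numerator is (1 - c (t - 1/2)) + c (t - 1/2) u, so division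
    by u^k leaves the powers -k and -(k - 1).\<close>
  have "(\<integral>s. exp (- \<beta> * model_interaction k a \<beta> s t) \<partial>unit_measure)
    = (\<integral>s. (1 - ?c * (t - 1/2)) / a ^ k * (1 / (s + 1/2) ^ k)
        + ?c * (t - 1/2) / a ^ k * (1 / (s + 1/2) ^ Suc m) \<partial>unit_measure)"
  proof (rule Bochner_Integration.integral_cong[OF refl])
    fix s assume "s \<in> space unit_measure"
    then have s: "s \<in> {0..1}" by simp
    define v where "v = s + 1/2"
    have v: "v > 0" "s - 1/2 = v - 1" using s by (auto simp: v_def)
    show "exp (- \<beta> * model_interaction k a \<beta> s t) = (1 - ?c * (t - 1/2)) / a ^ k * (1 / (s + 1/2) ^ k)
        + ?c * (t - 1/2) / a ^ k * (1 / (s + 1/2) ^ Suc m)"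
      unfolding exp_model_interaction[OF assms(1-3) s assms(4)] v_def[symmetric] v(2)
      using v(1) assms(2) by (simp add: k(1) divide_simps) (simp add: algebra_simps)
  qed
  also have "\<dots> = (1 - ?c * (t - 1/2)) / a ^ k * I k + ?c * (t - 1/2) / a ^ k * I (Suc m)"
    unfolding I_def
    by (subst Bochner_Integration.integral_add)
      (intro integrable_mult_right int integral_mult_right_zero arg_cong2[where f = "(+)"])+
  also have "\<dots> = (I k + (t - 1/2) * (?c * (I (Suc m) - I k))) / a ^ k"
    by (simp add: add_divide_distrib diff_divide_distrib algebra_simps)
  also have "\<dots> = I k * (t + 1/2) / a ^ k"
    unfolding c by (simp add: algebra_simps)
  also have "\<dots> = D * (2 * t + 1)"
  proof -
    have "D = I k / a ^ k / 2"
      unfolding D_def I(1) by (simp add: k(1) add.commute)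
    then show ?thesis by (simp add: algebra_simps add_divide_distrib)
  qed
  finally show ?thesis .
qed

text \<open>Since (2 s + 1)^k = 2^k (s + 1/2)^k, the boundary factor cancels the denominator of the
  kernel. Only the numerator remains, and its mean over s is 1 for every t.\<close>

lemma kernel_integral_power:
  assumes "k \<ge> 4" "a > 0" "\<beta> > 0" "t \<in> {0..1}"
  shows "(\<integral>s. exp (- \<beta> * model_interaction k a \<beta> s t + real k * ln (2 * s + 1)) \<partial>unit_measure)
    = (2 / a) ^ k"
proof -
  let ?c = "coupling_const k * (t - 1/2)"
  have "(\<integral>s. exp (- \<beta> * model_interaction k a \<beta> s t + real k * ln (2 * s + 1)) \<partial>unit_measure)
    = (\<integral>s. (2 / a) ^ k * (1 + ?c * (s - 1/2)) \<partial>unit_measure)"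
  proof (rule Bochner_Integration.integral_cong[OF refl])
    fix s assume "s \<in> space unit_measure"
    then have s: "s \<in> {0..1}" by simp
    have "exp (real k * ln (2 * s + 1)) = (2 * (s + 1/2)) ^ k"
      using s by (simp add: exp_of_nat_mult algebra_simps)
    then show "exp (- \<beta> * model_interaction k a \<beta> s t + real k * ln (2 * s + 1))
        = (2 / a) ^ k * (1 + ?c * (s - 1/2))"
      unfolding exp_add exp_model_interaction[OF assms(1-3) s assms(4)] power_mult_distrib
      using s assms(2) by (simp add: power_divide divide_simps)
  qed
  also have "\<dots> = (2 / a) ^ k * (\<integral>s. 1 + ?c * (s - 1/2) \<partial>unit_measure)"
    by (rule integral_mult_right_zero)
  also have "(\<integral>s. 1 + ?c * (s - 1/2) \<partial>unit_measure)
    = (1 + ?c * ((1 - 1/2)\<^sup>2 / 2)) - (0 + ?c * ((0 - 1/2)\<^sup>2 / 2))"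
    by (rule unit_integral_FTC[where F = "\<lambda>s. s + ?c * ((s - 1/2)\<^sup>2 / 2)"])
      (auto intro!: derivative_eq_intros continuous_intros)
  finally show ?thesis by (simp add: power2_eq_square)
qed

text \<open>The logarithm of (2 t + 1)^k on one parity class and of 1 on the other;
  \<open>b = True\<close> puts the power on the even vertices. The factor 2 makes the function
  vanish at t = 0, as the normalization by \<open>h 0 x\<close> suggests.\<close>

definition alternating_boundary :: "nat \<Rightarrow> 'v set set \<Rightarrow> 'v \<Rightarrow> bool \<Rightarrow> real \<Rightarrow> 'v \<Rightarrow> real" where
  "alternating_boundary k L x0 b t x = (if even (graph_dist L x x0) = b then real k * ln (2 * t + 1) else 0)"

section \<open>The two periodic measures\<close>

context rooted_cayley_tree
begin

text \<open>Successors have the opposite parity. Below a vertex carrying the power, k trivial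
  successors contribute k factors proportional to 2 t + 1; below a trivial vertex, each successor
  carries the power and contributes a constant.\<close>

lemma splitting_boundary_alternating:
  assumes "k \<ge> 4" "a > 0" "\<beta> > 0"
  shows "splitting_boundary V L x0 k \<beta> (model_interaction k a \<beta>) (alternating_boundary k L x0 b)"
proof unfold_locales
  show "continuous_on ({0..1} \<times> {0..1}) (\<lambda>(s, t). model_interaction k a \<beta> s t)"
    using assms(1,2) by (rule model_interaction_cont)
  show "continuous_on {0..1} (\<lambda>t. alternating_boundary k L x0 b t x)" for x
    unfolding alternating_boundary_def by (cases "even (depth x) = b") (auto intro!: continuous_intros)
  fix y assume "y \<in> V - {x0}"
  then have card: "card (children y) = k" by (simp add: card_children)
  have par: "even (depth x) \<longleftrightarrow> odd (depth y)" if "x \<in> children y" for x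
    using that by (simp add: direct_successors_def)
  let ?I = "\<lambda>t. \<Prod>x\<in>children y. \<integral>s. exp (- \<beta> * model_interaction k a \<beta> s t
    + alternating_boundary k L x0 b s x) \<partial>unit_measure"
  show "\<exists>C. \<forall>t\<in>{0..1}. ?I t = C * exp (alternating_boundary k L x0 b t y)"
  proof (cases "even (depth y) = b")
    case True
    define D where "D = 2 ^ (k - 2) * (1 - (1/3) ^ (k - 1)) / ((real k - 1) * a ^ k)"
    have "?I t = D ^ k * exp (alternating_boundary k L x0 b t y)" if t: "t \<in> {0..1}" for t
    proof -
      have "?I t = (\<Prod>x\<in>children y. D * (2 * t + 1))"
      proof (rule prod.cong[OF refl])
        fix x assume "x \<in> children y"
        with True have "alternating_boundary k L x0 b s x = 0" for s
          by (auto simp: alternating_boundary_def par)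
        then show "(\<integral>s. exp (- \<beta> * model_interaction k a \<beta> s t
            + alternating_boundary k L x0 b s x) \<partial>unit_measure) = D * (2 * t + 1)"
          using kernel_integral_const[OF assms t] by (simp add: D_def)
      qed
      also have "\<dots> = D ^ k * (2 * t + 1) ^ k" by (simp add: card power_mult_distrib)
      also have "(2 * t + 1) ^ k = exp (alternating_boundary k L x0 b t y)"
        using True t by (simp add: alternating_boundary_def exp_of_nat_mult)
      finally show ?thesis .
    qed
    then show ?thesis by blast
  next
    case False
    have "?I t = ((2 / a) ^ k) ^ k * exp (alternating_boundary k L x0 b t y)" if t: "t \<in> {0..1}" for t
    proof -
      have "?I t = (\<Prod>x\<in>children y. (2 / a) ^ k)"
      proof (rule prod.cong[OF refl])
        fix x assume "x \<in> children y"
        with False have "alternating_boundary k L x0 b s x = real k * ln (2 * s + 1)" for s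
          by (auto simp: alternating_boundary_def par)
        then show "(\<integral>s. exp (- \<beta> * model_interaction k a \<beta> s t
            + alternating_boundary k L x0 b s x) \<partial>unit_measure) = (2 / a) ^ k"
          using kernel_integral_power[OF assms t] by simp
      qed
      also have "\<dots> = ((2 / a) ^ k) ^ k * exp (alternating_boundary k L x0 b t y)"
        using False by (simp add: alternating_boundary_def card)
      finally show ?thesis .
    qed
    then show ?thesis by blast
  qed
qed

lemma periodic_gibbs_measure_alternating:
  assumes "k > 0" "splitting_gibbs_measure V L x0 \<beta> \<phi> (alternating_boundary k L x0 b) \<mu>"
  shows "periodic_gibbs_measure V L x0 \<beta> \<phi> \<mu>"
proof -
  \<comment> \<open>\<open>f True\<close> is the law on even vertices and \<open>f False\<close>
    that on odd ones; the one whose index equals \<open>b\<close> is the power.\<close>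
  define f where "f c t = (if c = b then (2 * t + 1) ^ k else 1)" for c and t :: real
  have "continuous_on {0..1} (f c)" for c
    unfolding f_def by (cases "c = b") (auto intro!: continuous_intros)
  moreover have "f c t > 0" if "t \<in> {0..1}" for c t
    using that by (simp add: f_def)
  \<comment> \<open>The two laws agree at t = 0, so they are compared at t = 1, where they take the
    values 3^k and 1.\<close>
  moreover have "f True 1 \<noteq> f False 1"
  proof -
    have "(1::real) < 3 ^ k" using assms(1) by (intro one_less_power) auto
    then show ?thesis by (auto simp: f_def)
  qed
  moreover have "exp (alternating_boundary k L x0 b t x - alternating_boundary k L x0 b 0 x)
      = (if even (depth x) then f True t else f False t)" if "t \<in> {0..1}" for t x
    using that by (auto simp: f_def alternating_boundary_def exp_of_nat_mult)
  ultimately show ?thesis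
    unfolding periodic_gibbs_measure_def
    using assms(2)
    by (intro exI[of _ "alternating_boundary k L x0 b"] exI[of _ "f True"] exI[of _ "f False"]
        conjI ballI bexI[of _ 1]) auto
qed

lemma alternating_gibbs_measures_differ:
  assumes "k \<ge> 4" "a > 0" "\<beta> > 0"
    and "splitting_gibbs_measure V L x0 \<beta> (model_interaction k a \<beta>) (alternating_boundary k L x0 True) \<mu>\<^sub>1"
    and "splitting_gibbs_measure V L x0 \<beta> (model_interaction k a \<beta>) (alternating_boundary k L x0 False) \<mu>\<^sub>2"
  shows "\<mu>\<^sub>1 \<noteq> \<mu>\<^sub>2"
proof
  assume eq: "\<mu>\<^sub>1 = \<mu>\<^sub>2"
  let ?\<phi> = "model_interaction k a \<beta>" and ?h = "alternating_boundary k L x0"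
  interpret P: splitting_boundary V L x0 k \<beta> ?\<phi> "?h True"
    using assms(1-3) by (rule splitting_boundary_alternating)
  interpret Q: splitting_boundary V L x0 k \<beta> ?\<phi> "?h False"
    using assms(1-3) by (rule splitting_boundary_alternating)
  let ?A = "tree_ball (Suc 0)" and ?S = "tree_sphere (Suc 0)"
  have "density (config_measure ?A) (\<lambda>\<sigma>. ennreal (P.dens (Suc 0) \<sigma>))
      = density (config_measure ?A) (\<lambda>\<sigma>. ennreal (Q.dens (Suc 0) \<sigma>))"
    using assms(4,5) eq unfolding splitting_gibbs_measure_def
    by (metis One_nat_def le_refl)
  \<comment> \<open>Finite mass is the condition under which equal measures have almost everywhere
    equal densities.\<close>
  moreover have "(\<integral>\<^sup>+\<sigma>. ennreal (P.dens (Suc 0) \<sigma>) \<partial>config_measure ?A) \<noteq> \<infinity>"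
    using P.dens_integral[of 0] P.dens_pos[of 0]
    by (subst nn_integral_eq_integral) (auto intro: less_imp_le)
  ultimately have AE: "AE \<sigma> in config_measure ?A. ennreal (P.dens (Suc 0) \<sigma>) = ennreal (Q.dens (Suc 0) \<sigma>)"
    using P.dens_measurable[of 0] Q.dens_measurable[of 0]
    by (subst (asm) finite_density_unique) auto
  define R where "R = Q.Z (Suc 0) / P.Z (Suc 0)"
  have prod_eq: "(\<Prod>x\<in>?S. (2 * \<sigma> x + 1) ^ k) = R"
    if d: "ennreal (P.dens (Suc 0) \<sigma>) = ennreal (Q.dens (Suc 0) \<sigma>)"
      and \<sigma>: "\<sigma> \<in> space (config_measure ?A)" for \<sigma>
  proof -
    \<comment> \<open>The whole sphere is odd: the law with \<open>True\<close> is trivial on it and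
      the law with \<open>False\<close> puts the power at each of its vertices. The factor
      \<open>E\<close> is common to both weights and cancels.\<close>
    have odd: "depth x = 1" if "x \<in> ?S" for x using that by (simp add: sphere_at_def)
    define E where "E = exp (- \<beta> * hamiltonian L x0 ?\<phi> ?A \<sigma>)"
    have "P.weight (Suc 0) \<sigma> = E"
      by (simp add: gibbs_weight_def E_def alternating_boundary_def odd)
    moreover have "Q.weight (Suc 0) \<sigma> = E * (\<Prod>x\<in>?S. exp (?h False (\<sigma> x) x))"
      unfolding gibbs_weight_def E_def exp_add exp_sum[OF finite_sphere] ..
    moreover have "(\<Prod>x\<in>?S. exp (?h False (\<sigma> x) x)) = (\<Prod>x\<in>?S. (2 * \<sigma> x + 1) ^ k)"
    proof (rule prod.cong[OF refl])
      fix x assume x: "x \<in> ?S"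
      then have "\<sigma> x \<ge> 0" using config_eval_in_unit[OF \<sigma> P.sphereD(1)] by simp
      then show "exp (?h False (\<sigma> x) x) = (2 * \<sigma> x + 1) ^ k"
        by (simp add: alternating_boundary_def odd[OF x] exp_of_nat_mult)
    qed
    moreover have "P.dens (Suc 0) \<sigma> = Q.dens (Suc 0) \<sigma>"
      using d P.dens_pos[of 0 \<sigma>] Q.dens_pos[of 0 \<sigma>] by simp
    ultimately show ?thesis
      using P.Z_pos[of 0] Q.Z_pos[of 0] by (simp add: gibbs_density_def R_def E_def field_simps)
  qed
  from AE have AE: "AE \<sigma> in config_measure ?A. (\<Prod>x\<in>?S. (2 * \<sigma> x + 1) ^ k) = R"
    by (rule AE_mp) (auto intro!: AE_I2 prod_eq)
  have sub: "?S \<subseteq> ?A" by (rule sphere_subset_ball)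
  \<comment> \<open>A nonempty sphere makes the final comparison of the two constant products
    strict.\<close>
  have card: "card ?S = k + 1"
    using card_neighbours[OF root] sphere_Suc[of 0] ball_0 children_root
    by (simp add: ball_at_def sphere_at_def)
  \<comment> \<open>On spins at most 1/4 the factor 2 s + 1 is at most 3/2, on spins at least 3/4 it
    is at least 5/2. Two such separated boxes cannot share the value \<open>R\<close>.\<close>
  obtain \<sigma> where \<sigma>: "\<sigma> \<in> ?A \<rightarrow>\<^sub>E {0..1/4}" "(\<Prod>x\<in>?S. (2 * \<sigma> x + 1) ^ k) = R"
    by (rule AE_config_measure_box[OF finite_ball _ _ _ AE, of "{0..1/4}"]) auto
  obtain \<tau> where \<tau>: "\<tau> \<in> ?A \<rightarrow>\<^sub>E {3/4..1}" "(\<Prod>x\<in>?S. (2 * \<tau> x + 1) ^ k) = R"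
    by (rule AE_config_measure_box[OF finite_ball _ _ _ AE, of "{3/4..1}"]) auto
  have "0 \<le> \<sigma> x \<and> \<sigma> x \<le> 1/4" "3/4 \<le> \<tau> x" if "x \<in> ?S" for x
    using PiE_mem[OF \<sigma>(1), of x] PiE_mem[OF \<tau>(1), of x] subsetD[OF sub that] by auto
  note bounds = this
  have "R \<le> (\<Prod>x\<in>?S. (3/2) ^ k)"
    unfolding \<sigma>(2)[symmetric]
    by (intro prod_mono conjI power_mono zero_le_power) (use bounds(1) in force)+
  also have "\<dots> < (\<Prod>x\<in>?S. (5/2) ^ k)"
    unfolding prod_constant card using assms(1) by (intro power_strict_mono) auto
  also have "\<dots> \<le> R"
    unfolding \<tau>(2)[symmetric]
    by (intro prod_mono conjI power_mono zero_le_power) (use bounds(2) in force)+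
  finally show False by simp
qed

end

theorem theorem8p3:
  fixes V :: "'v set" and L :: "'v set set" and x0 :: 'v
    and k :: nat and a \<beta> :: real
  assumes "cayley_tree k V L" and "x0 \<in> V"
    and "k \<ge> 4" and "a > 0" and "\<beta> > 0"
  shows "\<exists>\<mu>\<^sub>1 \<mu>\<^sub>2. \<mu>\<^sub>1 \<noteq> \<mu>\<^sub>2 \<and>
           periodic_gibbs_measure V L x0 \<beta> (model_interaction k a \<beta>) \<mu>\<^sub>1 \<and>
           periodic_gibbs_measure V L x0 \<beta> (model_interaction k a \<beta>) \<mu>\<^sub>2"
proof -
  interpret rooted_cayley_tree V L x0 k by standard (fact assms)+
  have k: "k > 0" using assms(3) by simp
  have ex: "\<exists>\<mu>. splitting_gibbs_measure V L x0 \<beta> (model_interaction k a \<beta>) (alternating_boundary k L x0 b) \<mu>" for b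
    using splitting_boundary_alternating[OF assms(3-5)]
    by (rule splitting_boundary.splitting_gibbs_measure_exists)
  obtain \<mu>\<^sub>1 where 1: "splitting_gibbs_measure V L x0 \<beta> (model_interaction k a \<beta>) (alternating_boundary k L x0 True) \<mu>\<^sub>1"
    using ex by blast
  obtain \<mu>\<^sub>2 where 2: "splitting_gibbs_measure V L x0 \<beta> (model_interaction k a \<beta>) (alternating_boundary k L x0 False) \<mu>\<^sub>2"
    using ex by blast
  show ?thesis
    using alternating_gibbs_measures_differ[OF assms(3-5) 1 2]
      periodic_gibbs_measure_alternating[OF k 1] periodic_gibbs_measure_alternating[OF k 2] by blast
qed

end
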